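(* Let $\mathcal R_e(t),\mathcal S_e(t),\mathcal F_{0,e}(t)\in\mathcal A[[t^{1/2}]]$ be obtained from $\mathcal R,\mathcal S,\mathcal F_0\in\mathcal A=\mathbb Q[[a_1,a_2,\dots]]$ by substituting $a_nt^{n/2}$ for $a_n$, for all $n\ge1$. Then, as formal power series, $$\mathcal F_{0,e}(t)=\frac1t\int_0^t\frac{(t-s)\big(2\mathcal R_e(s)\mathcal S_e^2(s)+\mathcal R_e^2(s)-1\big)}{2s}\,ds,$$ and it follows that $$(t^2\mathcal F_{0,e}')'=\frac{2\mathcal R_e(t)\mathcal S_e^2(t)+\mathcal R_e^2(t)-1}{2},$$ where $'$ denotes the derivative with respect to $t$.
   Context: $\mathcal A=\mathbb Q[[a_1,a_2,\dots]]$ is the ring of formal power series in infinitely many variables, $\mathcal A^+$ the series with zero constant term. $(\mathcal R,\mathcal S)$ is the unique pair with $\mathcal R\in1+\mathcal A^+$, $\mathcal S\in\mathcal A^+$ satisfying $$\mathcal R=1+\sum_{n\ge1}a_n\sum_{j\ge1}\binom{n-1}{j-1}\binom{n-j}{j}\mathcal R^j\mathcal S^{n-2j},\qquad \mathcal S=\sum_{n\ge1}a_n\sum_{j\ge0}\binom{n-1}{2j}\binom{2j}{j}\mathcal R^j\mathcal S^{n-2j-1}.$$ Let $\mathcal H_N$ be the space of $N\times N$ Hermitian matrices and $$\mathcal Z=\frac{\int_{\mathcal H_N}\exp\!\big(-N\,\mathrm{Tr}\,(M^2/2)+N\sum_{n\ge1}\frac{a_n}{n}\mathrm{Tr}(M^n)\big)dM}{\int_{\mathcal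 H_N}\exp(-N\,\mathrm{Tr}(M^2/2))dM},$$ where the factor $\exp(N\sum_n\frac{a_n}{n}\mathrm{Tr}(M^n))$ is expanded as a power series in the $a_n$ and integrated coefficient by coefficient against the normalized Gaussian. Then $\mathcal F=\log\mathcal Z\in N^2\mathcal A[[1/N^2]]$, written $\mathcal F=\sum_{g\ge0}N^{2-2g}\mathcal F_g$ with $\mathcal F_g\in\mathcal A$; $\mathcal F_0$ is the formal planar limit. Integrals and derivatives in $t$ of formal power series are taken termwise. *)

theory Defs
  imports
    "HOL-Probability.Probability"
    "HOL-Library.Multiset"
    "HOL-Computational_Algebra.Formal_Laurent_Series"
    "Jordan_Normal_Form.Matrix"
    "Jordan_Normal_Form.Schur_Decomposition"
begin

section \<open>Formal power series in infinitely many variables\<close>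

text \<open>
  A monomial is a finite multiset of variables, the multiplicity of a variable being its exponent.
  A series is an arbitrary family of coefficients indexed by the monomials.
\<close>

typedef ('v, 'a) mseries = "UNIV :: ('v multiset \<Rightarrow> 'a) set"
  morphisms mcoeff Abs_mseries ..

setup_lifting type_definition_mseries

lemma mseries_eqI: "(\<And>m. mcoeff f m = mcoeff g m) \<Longrightarrow> f = g"
  by transfer auto

lemma finite_subset_mset: "finite {a. a \<subseteq># (m :: 'v multiset)}"
proof -
  have "{a. a \<subseteq># m} \<subseteq> mset ` {xs. set xs \<subseteq> set_mset m \<and> length xs \<le> size m}"
  proof
    fix a assume "a \<in> {a. a \<subseteq># m}"
    hence a: "a \<subseteq># m" by simp
    obtain xs where xs: "mset xs = a" using ex_mset by blast
    have "set xs \<subseteq> set_mset m" using a xs by (metis set_mset_mono set_mset_mset)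
    moreover have "length xs \<le> size m" using a xs by (metis size_mset size_mset_mono)
    ultimately show "a \<in> mset ` {xs. set xs \<subseteq> set_mset m \<and> length xs \<le> size m}"
      using xs by blast
  qed
  moreover have "finite {xs. set xs \<subseteq> set_mset m \<and> length xs \<le> size m}"
    by (rule finite_lists_length_le) simp
  ultimately show ?thesis by (meson finite_imageI finite_subset)
qed

lemma finite_mset_splits: "finite {(a, b). a + b = (m :: 'v multiset)}"
proof -
  have "{(a, b). a + b = m} \<subseteq> {a. a \<subseteq># m} \<times> {a. a \<subseteq># m}" by auto
  thus ?thesis by (rule finite_subset) (intro finite_SigmaI finite_subset_mset)
qed

instantiation mseries :: (type, comm_ring_1) comm_ring_1
begin

lift_definition zero_mseries :: "('a, 'b) mseries" is "\<lambda>_. 0" .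
lift_definition one_mseries :: "('a, 'b) mseries" is "\<lambda>m. if m = {#} then 1 else 0" .
lift_definition plus_mseries :: "('a, 'b) mseries \<Rightarrow> ('a, 'b) mseries \<Rightarrow> ('a, 'b) mseries"
  is "\<lambda>f g m. f m + g m" .
lift_definition minus_mseries :: "('a, 'b) mseries \<Rightarrow> ('a, 'b) mseries \<Rightarrow> ('a, 'b) mseries"
  is "\<lambda>f g m. f m - g m" .
lift_definition uminus_mseries :: "('a, 'b) mseries \<Rightarrow> ('a, 'b) mseries"
  is "\<lambda>f m. - f m" .
lift_definition times_mseries :: "('a, 'b) mseries \<Rightarrow> ('a, 'b) mseries \<Rightarrow> ('a, 'b) mseries"
  is "\<lambda>f g m. \<Sum>(a, b) \<in> {(a, b). a + b = m}. f a * g b" .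

instance
proof
  fix f g h :: "('a, 'b) mseries"
  show "f + g + h = f + (g + h)" by transfer (simp add: add.assoc)
  show "f + g = g + f" by transfer (simp add: add.commute)
  show "0 + f = f" by transfer simp
  show "- f + f = 0" by transfer simp
  show "f - g = f + - g" by transfer simp
  show "(0 :: ('a, 'b) mseries) \<noteq> 1" by transfer (auto simp: fun_eq_iff)
  show "(f + g) * h = f * h + g * h"
    by transfer (simp add: fun_eq_iff case_prod_unfold distrib_right sum.distrib)
  show "f * g = g * f"
  proof transfer
    fix f g :: "'a multiset \<Rightarrow> 'b"
    show "(\<lambda>m. \<Sum>(a, b) \<in> {(a, b). a + b = m}. f a * g b) =
          (\<lambda>m. \<Sum>(a, b) \<in> {(a, b). a + b = m}. g a * f b)"
    proof
      fix m
      show "(\<Sum>(a, b) \<in> {(a, b). a + b = m}. f a * g b) =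
            (\<Sum>(a, b) \<in> {(a, b). a + b = m}. g a * f b)"
        by (rule sum.reindex_bij_witness[of _ prod.swap prod.swap])
           (auto simp: add.commute mult.commute)
    qed
  qed
  show "1 * f = f"
  proof transfer
    fix f :: "'a multiset \<Rightarrow> 'b"
    show "(\<lambda>m. \<Sum>(a, b) \<in> {(a, b). a + b = m}. (if a = {#} then 1 else 0) * f b) = f"
    proof
      fix m
      have "(\<Sum>(a, b) \<in> {(a, b). a + b = m}. (if a = {#} then 1 else 0) * f b) =
            (\<Sum>(a, b) \<in> {({#} :: 'a multiset, m)}. (if a = {#} then 1 else 0) * f b)"
        by (rule sum.mono_neutral_right) (auto simp: finite_mset_splits split: if_splits)
      thus "(\<Sum>(a, b) \<in> {(a, b). a + b = m}. (if a = {#} then 1 else 0) * f b) = f m"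
        by simp
    qed
  qed
  show "f * g * h = f * (g * h)"
  proof transfer
    fix f g h :: "'a multiset \<Rightarrow> 'b"
    show "(\<lambda>m. \<Sum>(p, c) \<in> {(a, b). a + b = m}.
              (\<Sum>(a, b) \<in> {(a, b). a + b = p}. f a * g b) * h c) =
          (\<lambda>m. \<Sum>(a, q) \<in> {(a, b). a + b = m}.
              f a * (\<Sum>(b, c) \<in> {(a, b). a + b = q}. g b * h c))" (is "?L = ?R")
    proof
      fix m
      have "?L m = (\<Sum>x \<in> {(a, b). a + b = m}. \<Sum>y \<in> {(a, b). a + b = fst x}.
                      f (fst y) * g (snd y) * h (snd x))"
        by (simp add: case_prod_unfold sum_distrib_right)
      also have "\<dots> = (\<Sum>(x, y) \<in> Sigma {(a, b). a + b = m} (\<lambda>x. {(a, b). a + b = fst x}).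
                      f (fst y) * g (snd y) * h (snd x))"
        by (rule sum.Sigma) (use finite_mset_splits in auto)
      also have "\<dots> = (\<Sum>(x, y) \<in> Sigma {(a, b). a + b = m} (\<lambda>x. {(a, b). a + b = snd x}).
                      f (fst x) * (g (fst y) * h (snd y)))"
        by (rule sum.reindex_bij_witness[of _
              "\<lambda>((a, q), (b, c)). ((a + b, c), (a, b))"
              "\<lambda>((p, c), (a, b)). ((a, b + c), (b, c))"])
           (auto simp: add.assoc mult.assoc)
      also have "\<dots> = (\<Sum>x \<in> {(a, b). a + b = m}. \<Sum>y \<in> {(a, b). a + b = snd x}.
                      f (fst x) * (g (fst y) * h (snd y)))"
        by (rule sum.Sigma[symmetric]) (use finite_mset_splits in auto)
      also have "\<dots> = ?R m"
        by (simp add: case_prod_unfold sum_distrib_left)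
      finally show "?L m = ?R m" .
    qed
  qed
qed

end

definition mconst :: "'a :: zero \<Rightarrow> ('v, 'a) mseries" where
  "mconst c = Abs_mseries (\<lambda>m. if m = {#} then c else 0)"

definition mvar :: "'v \<Rightarrow> ('v, 'a :: zero_neq_one) mseries" where
  "mvar v = Abs_mseries (\<lambda>m. if m = {#v#} then 1 else 0)"

text \<open>
  The sum of a family of series in which every monomial has a nonzero coefficient in only
  finitely many members (the only kind of family it is used for below).
\<close>

definition msum :: "('i \<Rightarrow> ('v, 'a :: comm_monoid_add) mseries) \<Rightarrow> 'i set \<Rightarrow> ('v, 'a) mseries" where
  "msum f I = Abs_mseries (\<lambda>m. \<Sum>i \<in> {i \<in> I. mcoeff (f i) m \<noteq> 0}. mcoeff (f i) m)"

text \<open>Exponential of a series with constant term 0 and logarithm of a series with constant term 1.\<close>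

definition mexp :: "('v, 'a :: field_char_0) mseries \<Rightarrow> ('v, 'a) mseries" where
  "mexp f = msum (\<lambda>k. mconst (1 / fact k) * f ^ k) UNIV"

definition mln :: "('v, 'a :: field_char_0) mseries \<Rightarrow> ('v, 'a) mseries" where
  "mln f = msum (\<lambda>k. mconst ((- 1) ^ (k + 1) / of_nat k) * (f - 1) ^ k) {1..}"


section \<open>The ring of power series in the variables a(1), a(2), ...\<close>

text \<open>
  The index set of the variables is the type of natural numbers, so the variable with index k
  plays the role of a(k + 1); there is no a(0), and avar is only to be applied to positive numbers.
\<close>

type_synonym 'a aseries = "(nat, 'a) mseries"

definition avar :: "nat \<Rightarrow> 'a :: zero_neq_one aseries" where
  "avar n = mvar (n - 1)"

text \<open>
  In the inner sums, the binomial coefficients vanish for the values of j left out.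
\<close>

definition RS_system :: "rat aseries \<Rightarrow> rat aseries \<Rightarrow> bool" where
  "RS_system R S \<longleftrightarrow>
     mcoeff R {#} = 1 \<and> mcoeff S {#} = 0 \<and>
     R = 1 + msum (\<lambda>n. avar n *
           (\<Sum>j \<in> {1..n div 2}. of_nat (((n - 1) choose (j - 1)) * ((n - j) choose j))
              * R ^ j * S ^ (n - 2 * j))) {1..} \<and>
     S = msum (\<lambda>n. avar n *
           (\<Sum>j \<in> {0..(n - 1) div 2}. of_nat (((n - 1) choose (2 * j)) * ((2 * j) choose j))
              * R ^ j * S ^ (n - 2 * j - 1))) {1..}"


section \<open>The Hermitian one-matrix integral\<close>

definition mtrace :: "'a :: comm_monoid_add mat \<Rightarrow> 'a" where
  "mtrace A = (\<Sum>i < dim_row A. A $$ (i, i))"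

text \<open>
  Linear coordinates on the real vector space of Hermitian matrices of size N: the diagonal
  entries, and for i < j the real part x (i, j) and the imaginary part x (j, i) of the entry at
  (i, j). The normalization of the Lebesgue measure cancels in the quotient defining gauss_mean.
\<close>

definition herm :: "nat \<Rightarrow> (nat \<times> nat \<Rightarrow> real) \<Rightarrow> complex mat" where
  "herm N x = mat N N (\<lambda>(i, j).
     if i = j then complex_of_real (x (i, i))
     else if i < j then Complex (x (i, j)) (x (j, i))
     else Complex (x (j, i)) (- x (i, j)))"

lemma mat_adjoint_index:
  assumes "A \<in> carrier_mat m n" "i < n" "j < m"
  shows "mat_adjoint A $$ (i, j) = conjugate (A $$ (j, i))"
  using assms by (auto simp: mat_adjoint_def mat_of_rows_index)

lemma herm_bij:
  "bij_betw (herm N) (PiE ({..<N} \<times> {..<N}) (\<lambda>_. UNIV)) {M \<in> carrier_mat N N. mat_adjoint M = M}"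
proof (rule bij_betw_byWitness[where f' = "\<lambda>M. restrict
      (\<lambda>(i, j). if i \<le> j then Re (M $$ (i, j)) else Im (M $$ (j, i))) ({..<N} \<times> {..<N})"], goal_cases)
  case 1
  show ?case
    by (auto simp: herm_def fun_eq_iff PiE_def extensional_def split: if_splits)
next
  case 2
  show ?case
  proof
    fix M :: "complex mat" assume "M \<in> {M \<in> carrier_mat N N. mat_adjoint M = M}"
    hence M: "M \<in> carrier_mat N N" and adj: "mat_adjoint M = M" by auto
    have "cnj (M $$ (j, i)) = M $$ (i, j)" if "i < N" "j < N" for i j
      using adj mat_adjoint_index[of M N N i j] M that by simp
    hence conj: "M $$ (i, j) = cnj (M $$ (j, i))" if "i < N" "j < N" for i j
      using that by metis
    have im: "Im (M $$ (i, i)) = 0" if "i < N" for i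
      using arg_cong[OF conj[OF that that], of Im] by simp
    show "herm N (restrict (\<lambda>(i, j). if i \<le> j then Re (M $$ (i, j)) else Im (M $$ (j, i)))
            ({..<N} \<times> {..<N})) = M"
    proof (rule eq_matI)
      fix i j assume "i < dim_row M" "j < dim_col M"
      hence ij: "i < N" "j < N" using M by auto
      show "herm N (restrict (\<lambda>(i, j). if i \<le> j then Re (M $$ (i, j)) else Im (M $$ (j, i)))
              ({..<N} \<times> {..<N})) $$ (i, j) = M $$ (i, j)"
        using ij im[of i] conj[OF ij] by (auto simp: herm_def complex_eq_iff)
    qed (use M in \<open>auto simp: herm_def\<close>)
  qed
next
  case 3
  show ?case
  proof safe
    fix x
    show "herm N x \<in> carrier_mat N N" by (simp add: herm_def)
    show "mat_adjoint (herm N x) = herm N x"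
    proof (rule eq_matI)
      fix i j assume "i < dim_row (herm N x)" "j < dim_col (herm N x)"
      hence "i < N" "j < N" by (auto simp: herm_def)
      thus "mat_adjoint (herm N x) $$ (i, j) = herm N x $$ (i, j)"
        using mat_adjoint_index[of "herm N x" N N i j]
        by (auto simp: herm_def complex_eq_iff)
    qed (auto simp: herm_def mat_adjoint_def)
  qed
next
  case 4
  show ?case by (auto simp: PiE_def split: if_splits)
qed

definition herm_lebesgue :: "nat \<Rightarrow> (nat \<times> nat \<Rightarrow> real) measure" where
  "herm_lebesgue N = (\<Pi>\<^sub>M p \<in> {..<N} \<times> {..<N}. lborel)"

definition gauss_weight :: "nat \<Rightarrow> complex mat \<Rightarrow> complex" where
  "gauss_weight N M = exp (- of_nat N * mtrace ((1 / 2) \<cdot>\<^sub>m (M ^\<^sub>m 2)))"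

definition gauss_mean :: "nat \<Rightarrow> (complex mat \<Rightarrow> complex) \<Rightarrow> complex" where
  "gauss_mean N f =
     (LINT x | herm_lebesgue N. f (herm N x) * gauss_weight N (herm N x)) /
     (LINT x | herm_lebesgue N. gauss_weight N (herm N x))"

definition interaction :: "nat \<Rightarrow> complex mat \<Rightarrow> complex aseries" where
  "interaction N M =
     mexp (mconst (of_nat N) * msum (\<lambda>n. avar n * mconst (1 / of_nat n * mtrace (M ^\<^sub>m n))) {1..})"

definition partition_series :: "nat \<Rightarrow> complex aseries" where
  "partition_series N = Abs_mseries (\<lambda>m. gauss_mean N (\<lambda>M. mcoeff (interaction N M) m))"

text \<open>
  The expansion of the free energy in powers of the matrix size. For each monomial the
  coefficient of the free energy is a Laurent polynomial in N, so that the sum over the genus is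
  finite coefficientwise.
\<close>

definition genus_expansion :: "(nat \<Rightarrow> rat aseries) \<Rightarrow> bool" where
  "genus_expansion F \<longleftrightarrow> (\<forall>m.
     finite {g. mcoeff (F g) m \<noteq> 0} \<and>
     (\<forall>N \<ge> 1. mcoeff (mln (partition_series N)) m =
        (\<Sum>g | mcoeff (F g) m \<noteq> 0. of_nat N powi (2 - 2 * int g) * of_rat (mcoeff (F g) m))))"

definition free_energy :: "nat \<Rightarrow> rat aseries" where
  "free_energy = (THE F. genus_expansion F)"


section \<open>Series in the square root of t\<close>

text \<open>
  A univariate power or Laurent series stands for a series in the square root of t: its k-th
  coefficient is that of t to the power k / 2, and t itself is the square of the formal variable.
\<close>

text \<open>
  Substituting a(n) times t to the n / 2 for every a(n) multiplies a monomial m by t to the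
  d / 2, where d is the weighted degree of m (the variable with index k being a(k + 1)).
\<close>

definition adeg :: "nat multiset \<Rightarrow> nat" where
  "adeg m = (\<Sum>k \<in># m. k + 1)"

definition scale_t :: "'a :: zero aseries \<Rightarrow> 'a aseries fps" where
  "scale_t f = Abs_fps (\<lambda>d. Abs_mseries (\<lambda>m. if adeg m = d then mcoeff f m else 0))"

definition t_var :: "rat aseries fls" where
  "t_var = fls_X ^ 2"

definition t_inv :: "rat aseries fls" where
  "t_inv = fls_X_inv ^ 2"

lemma t_inv_mult: "t_inv * t_var = 1"
  by (simp add: t_inv_def t_var_def fls_X_inv_power_times_conv_shift fls_X_power_conv_shift_1)

text \<open>The derivative with respect to t sends t to the k / 2 to k / 2 times t to the k / 2 - 1.\<close>

definition deriv_t :: "rat aseries fls \<Rightarrow> rat aseries fls" where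
  "deriv_t f = Abs_fls (\<lambda>k. mconst (of_int (k + 2) / 2) * fls_nth f (k + 2))"

lemma deriv_t_nth: "fls_nth (deriv_t f) k = mconst (of_int (k + 2) / 2) * fls_nth f (k + 2)"
  unfolding deriv_t_def
  by (rule nth_Abs_fls_lower_bound[of "fls_subdegree f - 2"]) simp

text \<open>
  For integrals over s from 0 to t, the integrand is a series in the square root of s whose
  coefficients are series in the square root of t. The definition is meaningful for integrands
  all of whose exponents of s are greater than -1.
\<close>

definition in_s :: "'a :: zero fps \<Rightarrow> 'a fps fls" where
  "in_s f = fps_to_fls (Abs_fps (\<lambda>k. fps_const (fps_nth f k)))"

definition s_var :: "rat aseries fps fls" where
  "s_var = fls_X ^ 2"

definition s_inv :: "rat aseries fps fls" where
  "s_inv = fls_X_inv ^ 2"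

definition t_const :: "rat aseries fps fls" where
  "t_const = fls_const (fps_X ^ 2)"

definition integral_0_t :: "rat aseries fps fls \<Rightarrow> rat aseries fps" where
  "integral_0_t G = Abs_fps (\<lambda>n. \<Sum>k \<in> {-1..int n - 2}.
     mconst (2 / of_int (k + 2)) * fps_nth (fls_nth G k) (nat (int n - 2 - k)))"

text \<open>The integrand of interest satisfies this condition.\<close>

lemma integrand_exponents:
  assumes "RS_system R S" "k < -1"
  shows "fls_nth (fls_const d * s_inv * (t_const - s_var) *
     (2 * in_s (scale_t R) * in_s (scale_t S) ^ 2 + in_s (scale_t R) ^ 2 - 1)) k = 0"
proof -
  define r where "r = Abs_fps (\<lambda>k. fps_const (fps_nth (scale_t R) k))"
  define q where "q = Abs_fps (\<lambda>k. fps_const (fps_nth (scale_t S) k))"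
  define P where "P = fps_const d * (fps_const (fps_X ^ 2) - fps_X ^ 2) * (2 * r * q ^ 2 + r ^ 2 - 1)"
  have adeg0: "adeg m = 0 \<longleftrightarrow> m = {#}" for m by (cases m) (auto simp: adeg_def)
  have "fps_nth (scale_t R) 0 = 1" "fps_nth (scale_t S) 0 = 0"
    using assms(1) unfolding RS_system_def scale_t_def
    by (auto intro!: mseries_eqI simp: adeg0 Abs_mseries_inverse zero_mseries.rep_eq one_mseries.rep_eq)
  hence "fps_nth r 0 = 1" "fps_nth q 0 = 0" by (auto simp: r_def q_def)
  hence P0: "fps_nth P 0 = 0" by (simp add: P_def fps_mult_nth_0 fps_power_zeroth)
  have "fls_const d * s_inv * (t_const - s_var) *
     (2 * in_s (scale_t R) * in_s (scale_t S) ^ 2 + in_s (scale_t R) ^ 2 - 1) =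
     fls_X_inv ^ 2 * fps_to_fls P"
    by (simp add: s_inv_def s_var_def t_const_def in_s_def P_def fls_times_fps_to_fls
          fps_to_fls_power mult_ac flip: r_def q_def)
  also have "fls_nth \<dots> k = fls_nth (fps_to_fls P) (k + 2)"
    by (simp add: fls_X_inv_power_times_conv_shift)
  also have "\<dots> = 0" using assms(2) P0 by (cases "k + 2 = 0") auto
  finally show ?thesis .
qed

end

theory Submission
  imports Defs
begin

text \<open>
  Gaussian integration by parts for the traces of powers of a Hermitian matrix yields the loop
  equations for the free energy. They determine its coefficients recursively by weight, which shows
  that these are polynomials in \<open>1 / N\<^sup>2\<close> up to the factor \<open>N\<^sup>2\<close>, and in the limit of large \<open>N\<close> they
  become quadratic equations for the planar moments \<open>w(n) = n dF\<^sub>0/da(n)\<close>. Differentiating these in \<open>a(2)\<close> gives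
  linear equations for the planar covariances \<open>u(n)\<close> of \<open>Tr(M\<^sup>n)\<close> and \<open>Tr(M\<^sup>2)\<close>.

  The loop equations for \<open>w\<close> and \<open>u\<close> have unique solutions, so it suffices to guess them. Under the
  substitution \<open>x = z + S + R / z\<close> the equations for \<open>R\<close> and \<open>S\<close> say that the derivative of the potential has no constant
  term and coefficient 1 at \<open>1 / z\<close>. Its part with negative powers of \<open>z\<close> is the resolvent of \<open>w\<close>, and \<open>u(n)\<close> depends on the potential
  only through \<open>R\<close> and \<open>S\<close>; in particular \<open>u(2) = 4 R S\<^sup>2 + 2 R\<^sup>2\<close>. On the part of \<open>F\<^sub>0\<close> of weight \<open>d\<close>, homogeneity gives
  \<open>d (d + 2) F\<^sub>0 = u(2)\<close> for \<open>d > 0\<close>, which is the assertion.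

  To avoid series infinite in both powers of \<open>z\<close>, all but finitely many of the variables \<open>a(n)\<close> are
  set to zero, which makes the potential a polynomial.
\<close>

section \<open>Coefficients of power series in infinitely many variables\<close>

lemma mcoeff_Abs [simp]: "mcoeff (Abs_mseries f) = f"
  by (simp add: Abs_mseries_inverse)

lemma mcoeff_zero [simp]: "mcoeff 0 m = 0"
  by (simp add: zero_mseries.rep_eq)

lemma mcoeff_one: "mcoeff 1 m = (if m = {#} then 1 else 0)"
  by (simp add: one_mseries.rep_eq)

lemma mcoeff_add [simp]: "mcoeff (f + g) m = mcoeff f m + mcoeff g m"
  by (simp add: plus_mseries.rep_eq)

lemma mcoeff_diff [simp]: "mcoeff (f - g) m = mcoeff f m - mcoeff g m"
  by (simp add: minus_mseries.rep_eq)

lemma mcoeff_uminus [simp]: "mcoeff (- f) m = - mcoeff f m"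
  by (simp add: uminus_mseries.rep_eq)

lemma mcoeff_mult: "mcoeff (f * g) m = (\<Sum>(a, b) \<in> {(a, b). a + b = m}. mcoeff f a * mcoeff g b)"
  by (simp add: times_mseries.rep_eq)

lemma mcoeff_sum [simp]: "mcoeff (sum f I) m = (\<Sum>i\<in>I. mcoeff (f i) m)"
  by (induction I rule: infinite_finite_induct) auto

lemma mcoeff_const: "mcoeff (mconst c) m = (if m = {#} then c else 0)"
  by (simp add: mconst_def)

lemma mcoeff_var: "mcoeff (mvar v) m = (if m = {#v#} then 1 else 0)"
  by (simp add: mvar_def)

lemma mcoeff_mult_empty [simp]: "mcoeff (f * g) {#} = mcoeff f {#} * mcoeff g {#}"
proof -
  have "{(a, b). a + b = ({#} :: 'a multiset)} = {({#}, {#})}" by auto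
  thus ?thesis by (simp add: mcoeff_mult)
qed

lemma mcoeff_const_mult [simp]:
  fixes f :: "('v, 'a :: comm_ring_1) mseries"
  shows "mcoeff (mconst c * f) m = c * mcoeff f m"
proof -
  have "mcoeff (mconst c * f) m = (\<Sum>(a, b) \<in> {({#} :: 'v multiset, m)}. mcoeff (mconst c) a * mcoeff f b)"
    unfolding mcoeff_mult
    by (rule sum.mono_neutral_right) (auto simp: finite_mset_splits mcoeff_const split: if_splits)
  thus ?thesis by (simp add: mcoeff_const)
qed

lemma mcoeff_mult_const [simp]: "mcoeff (f * mconst c) m = mcoeff f m * c"
  using mcoeff_const_mult[of c f m] by (simp only: mult.commute)

lemma mcoeff_var_mult:
  "mcoeff (mvar v * f) m = (if v \<in># m then mcoeff f (m - {#v#}) else 0)"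
proof (cases "v \<in># m")
  case True
  have "mcoeff (mvar v * f) m = (\<Sum>(a, b) \<in> {({#v#}, m - {#v#})}. mcoeff (mvar v) a * mcoeff f b)"
    unfolding mcoeff_mult
    by (rule sum.mono_neutral_right)
       (use True in \<open>auto simp: finite_mset_splits mcoeff_var split: if_splits\<close>)
  thus ?thesis using True by (simp add: mcoeff_var)
next
  case False
  have "mcoeff (mvar v * f) m = 0"
    unfolding mcoeff_mult
    by (rule sum.neutral) (use False in \<open>auto simp: mcoeff_var split: if_splits\<close>)
  thus ?thesis using False by simp
qed

lemma mconst_0 [simp]: "mconst 0 = 0"
  by (rule mseries_eqI) (simp add: mcoeff_const)

lemma mconst_1 [simp]: "mconst 1 = 1"
  by (rule mseries_eqI) (simp add: mcoeff_const mcoeff_one)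

lemma mconst_add: "mconst (a + b) = (mconst a + mconst b :: ('v, 'a :: comm_ring_1) mseries)"
  by (rule mseries_eqI) (simp add: mcoeff_const)

lemma mconst_mult: "mconst (a * b) = (mconst a * mconst b :: ('v, 'a :: comm_ring_1) mseries)"
  by (rule mseries_eqI) (simp add: mcoeff_const)

lemma mconst_of_nat: "mconst (of_nat n) = (of_nat n :: ('v, 'a :: comm_ring_1) mseries)"
  by (induction n) (simp_all add: mconst_add)

lemma mconst_numeral: "mconst (numeral n) = (numeral n :: ('v, 'a :: comm_ring_1) mseries)"
  using mconst_of_nat[of "numeral n"] by simp

lemma mcoeff_of_nat_mult [simp]: "mcoeff (of_nat n * f) m = of_nat n * mcoeff f m"
  by (simp flip: mconst_of_nat)

lemma mcoeff_numeral_mult [simp]: "mcoeff (numeral n * f) m = numeral n * mcoeff f m"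
  by (simp flip: mconst_numeral)

text \<open>Only submonomials of \<open>m\<close> enter its coefficient in a product. Partial sums
  can therefore stand in for infinite series, and inductions over monomials pass through
  products.\<close>

lemma mcoeff_mult_cong:
  assumes "\<And>a. a \<subseteq># m \<Longrightarrow> mcoeff f a = mcoeff f' a" "\<And>a. a \<subseteq># m \<Longrightarrow> mcoeff g a = mcoeff g' a"
  shows "mcoeff (f * g) m = mcoeff (f' * g') m"
  unfolding mcoeff_mult by (rule sum.cong) (use assms in auto)

text \<open>By induction on the size of \<open>m\<close>: apart from the term with the constant
  coefficient of \<open>h\<close>, the product of \<open>h\<close> and \<open>f - g\<close> at
  \<open>m\<close> involves \<open>f - g\<close> only at smaller monomials. It serves to cancel the
  partition series.\<close>

lemma mult_left_cancel_mseries: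
  fixes f g h :: "('v, 'a :: idom) mseries"
  assumes "mcoeff h {#} \<noteq> 0" "h * f = h * g"
  shows "f = g"
proof -
  have "mcoeff (f - g) m = 0" for m
  proof (induction m rule: measure_induct_rule[of size])
    case (less m)
    have "0 = mcoeff (h * (f - g)) m" using assms(2) by (simp add: algebra_simps)
    also have "\<dots> = (\<Sum>(a, b) \<in> {({#} :: 'v multiset, m)}. mcoeff h a * mcoeff (f - g) b)"
    proof -
      have "\<forall>a b. a + b = m \<longrightarrow> a \<noteq> {#} \<longrightarrow> mcoeff (f - g) b = 0"
      proof (intro allI impI)
        fix a b assume "a + b = m" "a \<noteq> {#}"
        hence "size b < size m" by (cases a) auto
        thus "mcoeff (f - g) b = 0" by (rule less.IH)
      qed
      thus ?thesis unfolding mcoeff_mult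
        by (intro sum.mono_neutral_right) (auto simp: finite_mset_splits simp del: mcoeff_diff, blast+)
    qed
    finally show ?case using assms(1) by simp
  qed
  thus ?thesis by (intro mseries_eqI) simp
qed

text \<open>Each factor uses up at least one variable. Hence exponential and logarithm are finite
  sums at every monomial.\<close>

lemma mcoeff_power_eq_0:
  assumes "mcoeff f {#} = 0" "size m < k"
  shows "mcoeff (f ^ k) m = 0"
  using assms(2)
proof (induction k arbitrary: m)
  case (Suc k)
  have "mcoeff f a * mcoeff (f ^ k) b = 0" if "a + b = m" for a b
  proof (cases "a = {#}")
    case False
    hence "size b < k" using that Suc.prems by (cases a) auto
    thus ?thesis using Suc.IH by simp
  qed (simp add: assms(1))
  thus ?case by (auto simp: mcoeff_mult intro!: sum.neutral)
qed simp

lemma mcoeff_msum: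
  assumes "finite J" "J \<subseteq> I" "\<And>i. i \<in> I - J \<Longrightarrow> mcoeff (f i) m = 0"
  shows "mcoeff (msum f I) m = (\<Sum>i\<in>J. mcoeff (f i) m)"
  unfolding msum_def mcoeff_Abs
  by (rule sum.mono_neutral_left) (use assms in auto)

subsection \<open>Partial derivatives\<close>

definition pd :: "'v \<Rightarrow> ('v, 'a :: comm_ring_1) mseries \<Rightarrow> ('v, 'a) mseries" where
  "pd v f = Abs_mseries (\<lambda>m. of_nat (Suc (count m v)) * mcoeff f (add_mset v m))"

lemma mcoeff_pd: "mcoeff (pd v f) m = of_nat (Suc (count m v)) * mcoeff f (add_mset v m)"
  by (simp add: pd_def)

lemma pd_add [simp]: "pd v (f + g) = pd v f + pd v g"
  by (rule mseries_eqI) (simp add: mcoeff_pd algebra_simps)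

lemma pd_diff [simp]: "pd v (f - g) = pd v f - pd v g"
  by (rule mseries_eqI) (simp add: mcoeff_pd algebra_simps)

lemma pd_const [simp]: "pd v (mconst c) = 0"
  by (rule mseries_eqI) (simp add: mcoeff_pd mcoeff_const)

lemma pd_zero [simp]: "pd v 0 = 0" and pd_one [simp]: "pd v 1 = 0"
  using pd_const[of v 0] pd_const[of v 1] by simp_all

lemma pd_sum [simp]: "pd v (sum f I) = (\<Sum>i\<in>I. pd v (f i))"
  by (induction I rule: infinite_finite_induct) auto

lemma pd_var: "pd v (mvar u) = (if u = v then 1 else 0)"
  by (rule mseries_eqI) (auto simp: mcoeff_pd mcoeff_var mcoeff_one)

text \<open>The exponent of \<open>v\<close> in \<open>a + b\<close> is the sum of the exponents in
  \<open>a\<close> and \<open>b\<close>; each of these accounts for one term of the product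
  rule.\<close>

lemma pd_mult: "pd v (f * g) = pd v f * g + f * pd v g"
proof -
  \<comment> \<open>Splittings without \<open>v\<close> in \<open>a\<close> have weight 0; in the
    others one \<open>v\<close> is removed from \<open>a\<close>.\<close>
  have half: "(\<Sum>(a, b) \<in> {(a, b). a + b = add_mset v m}. of_nat (count a v) * mcoeff f a * mcoeff g b)
       = mcoeff (pd v f * g) m" for f g :: "('a, 'b) mseries" and m
  proof -
    have "(\<Sum>(a, b) \<in> {(a, b). a + b = add_mset v m}. of_nat (count a v) * mcoeff f a * mcoeff g b) =
       (\<Sum>(a, b) \<in> {(a, b). a + b = add_mset v m \<and> v \<in># a}. of_nat (count a v) * mcoeff f a * mcoeff g b)"
    proof (rule sum.mono_neutral_right)
      show "\<forall>i\<in>{(a, b). a + b = add_mset v m} - {(a, b). a + b = add_mset v m \<and> v \<in># a}.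
          (case i of (a, b) \<Rightarrow> of_nat (count a v) * mcoeff f a * mcoeff g b) = 0"
      proof
        fix i assume "i \<in> {(a, b). a + b = add_mset v m} - {(a, b). a + b = add_mset v m \<and> v \<in># a}"
        then obtain a b where "i = (a, b)" "v \<notin># a" by auto
        thus "(case i of (a, b) \<Rightarrow> of_nat (count a v) * mcoeff f a * mcoeff g b) = 0"
          by (simp add: not_in_iff)
      qed
    qed (auto simp: finite_mset_splits)
    also have "\<dots> = (\<Sum>(a, b) \<in> {(a, b). a + b = m}. mcoeff (pd v f) a * mcoeff g b)"
      by (rule sum.reindex_bij_witness[of _ "\<lambda>(a, b). (add_mset v a, b)" "\<lambda>(a, b). (a - {#v#}, b)"])
         (auto simp: mcoeff_pd dest!: multi_member_split)
    finally show ?thesis by (simp add: mcoeff_mult)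
  qed
  show ?thesis
  proof (rule mseries_eqI)
    fix m
    have "mcoeff (pd v (f * g)) m =
       (\<Sum>(a, b) \<in> {(a, b). a + b = add_mset v m}. of_nat (Suc (count m v)) * (mcoeff f a * mcoeff g b))"
      by (simp add: mcoeff_pd mcoeff_mult sum_distrib_left case_prod_unfold del: of_nat_Suc)
    also have "\<dots> = (\<Sum>(a, b) \<in> {(a, b). a + b = add_mset v m}.
       of_nat (count a v) * mcoeff f a * mcoeff g b + of_nat (count b v) * mcoeff g b * mcoeff f a)"
    proof (rule sum.cong[OF refl], clarify)
      fix a b assume "a + b = add_mset v m"
      hence "Suc (count m v) = count a v + count b v"
        by (metis count_add_mset count_union)
      thus "of_nat (Suc (count m v)) * (mcoeff f a * mcoeff g b) =
         of_nat (count a v) * mcoeff f a * mcoeff g b + of_nat (count b v) * mcoeff g b * mcoeff f a"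
        by (simp add: algebra_simps del: of_nat_Suc)
    qed
    also have "\<dots> = mcoeff (pd v f * g) m +
        (\<Sum>(a, b) \<in> {(a, b). a + b = add_mset v m}. of_nat (count b v) * mcoeff g b * mcoeff f a)"
      by (simp add: case_prod_unfold sum.distrib flip: half)
    also have "(\<Sum>(a, b) \<in> {(a, b). a + b = add_mset v m}. of_nat (count b v) * mcoeff g b * mcoeff f a)
        = (\<Sum>(a, b) \<in> {(a, b). a + b = add_mset v m}. of_nat (count a v) * mcoeff g a * mcoeff f b)"
      by (rule sum.reindex_bij_witness[of _ prod.swap prod.swap]) (auto simp: add.commute)
    also have "\<dots> = mcoeff (f * pd v g) m"
      by (subst half) (simp only: mult.commute)
    finally show "mcoeff (pd v (f * g)) m = mcoeff (pd v f * g + f * pd v g) m" by simp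
  qed
qed

lemma pd_const_mult [simp]: "pd v (mconst c * f) = mconst c * pd v f"
  by (simp add: pd_mult)

lemma pd_power: "pd v (f ^ Suc k) = of_nat (Suc k) * f ^ k * pd v f"
  by (induction k) (simp_all add: pd_mult algebra_simps)

section \<open>Exponential and logarithm and their derivatives\<close>

lemma mcoeff_mexp:
  assumes "mcoeff f {#} = 0" "size m \<le> n"
  shows "mcoeff (mexp f) m = mcoeff (\<Sum>k\<le>n. mconst (1 / fact k) * f ^ k) m"
proof -
  have "mcoeff (mexp f) m = (\<Sum>k\<le>n. mcoeff (mconst (1 / fact k) * f ^ k) m)"
    unfolding mexp_def by (rule mcoeff_msum) (use assms in \<open>auto simp: mcoeff_power_eq_0\<close>)
  thus ?thesis by simp
qed

lemma mcoeff_mexp_empty: "mcoeff f {#} = 0 \<Longrightarrow> mcoeff (mexp f) {#} = 1"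
  by (subst mcoeff_mexp[where n = 0]) (auto simp: mcoeff_one)

text \<open>At a fixed monomial the exponential agrees with a partial sum \<open>e n\<close>, and
  the derivative of \<open>e (Suc n)\<close> is \<open>pd v f * e n\<close>.\<close>

lemma pd_mexp:
  fixes f :: "('v, 'a :: field_char_0) mseries"
  assumes "mcoeff f {#} = 0"
  shows "pd v (mexp f) = pd v f * mexp f"
proof (rule mseries_eqI)
  fix m :: "'v multiset"
  define e where "e n = (\<Sum>k\<le>n. mconst (1 / fact k) * f ^ k)" for n
  define n where "n = size m"
  \<comment> \<open>The derivative at \<open>m\<close> reads the coefficient at
    \<open>add_mset v m\<close>, one size larger, whence \<open>Suc n\<close>.\<close>
  have "mcoeff (pd v (mexp f)) m = mcoeff (pd v (e (Suc n))) m"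
    unfolding mcoeff_pd e_def by (subst mcoeff_mexp[OF assms, of _ "Suc n"]) (simp add: n_def, rule refl)
  also have "pd v (e (Suc n)) = (\<Sum>k\<le>n. pd v (mconst (1 / fact (Suc k)) * f ^ Suc k))"
    unfolding e_def by (subst sum.atMost_Suc_shift) simp
  also have "\<dots> = pd v f * e n"
    unfolding e_def sum_distrib_left
  proof (rule sum.cong[OF refl])
    fix k
    have "mconst (1 / fact (Suc k)) * of_nat (Suc k) = (mconst (1 / fact k) :: ('v, 'a) mseries)"
      unfolding mconst_of_nat[symmetric] mconst_mult[symmetric]
      by (simp add: field_simps del: of_nat_Suc)
    hence "mconst (1 / fact (Suc k)) * of_nat (Suc k) * (f ^ k * pd v f) = mconst (1 / fact k) * (f ^ k * pd v f)"
      by (rule arg_cong)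
    thus "pd v (mconst (1 / fact (Suc k)) * f ^ Suc k) = pd v f * (mconst (1 / fact k) * f ^ k)"
      by (simp only: pd_const_mult pd_power mult.assoc) (simp only: mult_ac)
  qed
  also have "mcoeff \<dots> m = mcoeff (pd v f * mexp f) m"
    by (rule mcoeff_mult_cong)
       (simp_all add: e_def n_def mcoeff_mexp[OF assms size_mset_mono] del: mcoeff_sum)
  finally show "mcoeff (pd v (mexp f)) m = mcoeff (pd v f * mexp f) m" .
qed

lemma mcoeff_mln:
  assumes "mcoeff g {#} = 1" "size m \<le> n"
  shows "mcoeff (mln g) m = mcoeff (\<Sum>k<n. mconst ((- 1) ^ k / of_nat (Suc k)) * (g - 1) ^ Suc k) m"
proof -
  have "mcoeff (mln g) m = (\<Sum>k\<in>{1..n}. mcoeff (mconst ((- 1) ^ (k + 1) / of_nat k) * (g - 1) ^ k) m)"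
    unfolding mln_def
  proof (rule mcoeff_msum)
    fix i assume "i \<in> {1..} - {1..n}"
    hence "mcoeff ((g - 1) ^ i) m = 0"
      using assms by (intro mcoeff_power_eq_0) (auto simp: mcoeff_one)
    thus "mcoeff (mconst ((- 1) ^ (i + 1) / of_nat i) * (g - 1) ^ i) m = 0" by simp
  qed auto
  also have "\<dots> = (\<Sum>k<n. mcoeff (mconst ((- 1) ^ (Suc k + 1) / of_nat (Suc k)) * (g - 1) ^ Suc k) m)"
    by (rule sum.reindex_bij_witness[of _ Suc "\<lambda>k. k - 1"]) auto
  finally show ?thesis by simp
qed

lemma mcoeff_mln_empty: "mcoeff g {#} = 1 \<Longrightarrow> mcoeff (mln g) {#} = 0"
  by (subst mcoeff_mln[where n = 0]) auto

text \<open>The factor \<open>g\<close> on the left avoids a division. The derivative of the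
  truncated logarithm is \<open>pd v f\<close> times a geometric sum in \<open>- f\<close>;
  multiplication by \<open>g = 1 + f\<close> collapses it to \<open>1 - (- f) ^ n\<close>, and the
  last power is invisible up to the size of \<open>m\<close>.\<close>

lemma pd_mln:
  fixes g :: "('v, 'a :: field_char_0) mseries"
  assumes "mcoeff g {#} = 1"
  shows "g * pd v (mln g) = pd v g"
proof (rule mseries_eqI)
  fix m :: "'v multiset"
  define f where "f = g - 1"
  have f0: "mcoeff f {#} = 0" by (simp add: f_def assms mcoeff_one)
  define l where "l n = (\<Sum>k<n. mconst ((- 1) ^ k / of_nat (Suc k)) * f ^ Suc k)" for n
  define n where "n = Suc (size m)"
  have "mcoeff (g * pd v (mln g)) m = mcoeff (g * pd v (l n)) m"
  proof (rule mcoeff_mult_cong)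
    fix a assume "a \<subseteq># m"
    hence le: "size (add_mset v a) \<le> n" by (auto simp: n_def dest: size_mset_mono)
    thus "mcoeff (pd v (mln g)) a = mcoeff (pd v (l n)) a"
      by (simp only: mcoeff_pd mcoeff_mln[OF assms le] l_def f_def)
  qed simp
  also have "pd v (l n) = (\<Sum>k<n. (- f) ^ k) * pd v f"
    unfolding l_def pd_sum sum_distrib_right
  proof (rule sum.cong[OF refl])
    fix k
    have "mconst ((- 1) ^ k / of_nat (Suc k)) * of_nat (Suc k) = (mconst ((- 1) ^ k) :: ('v, 'a) mseries)"
      unfolding mconst_of_nat[symmetric] mconst_mult[symmetric]
      by (simp del: of_nat_Suc)
    also have "\<dots> = (- 1) ^ k"
      by (cases "even k") (auto intro!: mseries_eqI simp: mcoeff_const mcoeff_one)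
    finally show "pd v (mconst ((- 1) ^ k / of_nat (Suc k)) * f ^ Suc k) = (- f) ^ k * pd v f"
      by (simp only: pd_const_mult pd_power power_minus[of f]) (metis mult.assoc)
  qed
  also have "g * ((\<Sum>k<n. (- f) ^ k) * pd v f) = pd v f - (- f) ^ n * pd v f"
  proof -
    have "1 - (- f) ^ n = g * (\<Sum>k<n. (- f) ^ k)"
      using one_diff_power_eq'[of "- f" n] by (simp add: f_def one_diff_power_eq)
    hence "(1 - (- f) ^ n) * pd v f = g * (\<Sum>k<n. (- f) ^ k) * pd v f" by (rule arg_cong)
    thus ?thesis by (simp only: left_diff_distrib mult_1 mult.assoc)
  qed
  also have "mcoeff \<dots> m = mcoeff (pd v f) m"
  proof -
    have "mcoeff ((- f) ^ n * pd v f) m = mcoeff (0 * pd v f) m"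
    proof (rule mcoeff_mult_cong)
      fix a assume "a \<subseteq># m"
      hence "size a < n" by (simp add: n_def less_Suc_eq_le size_mset_mono)
      thus "mcoeff ((- f) ^ n) a = mcoeff 0 a" by (simp add: f0 mcoeff_power_eq_0)
    qed simp
    thus ?thesis by simp
  qed
  also have "pd v f = pd v g" by (simp add: f_def)
  finally show "mcoeff (g * pd v (mln g)) m = mcoeff (pd v g) m" .
qed

subsection \<open>Truncation to finitely many variables\<close>

text \<open>Substitution of 0 for all variables outside \<open>V\<close>, and so a ring
  homomorphism.\<close>

definition trunc :: "'v set \<Rightarrow> ('v, 'a :: comm_ring_1) mseries \<Rightarrow> ('v, 'a) mseries" where
  "trunc V f = Abs_mseries (\<lambda>m. if set_mset m \<subseteq> V then mcoeff f m else 0)"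

lemma mcoeff_trunc: "mcoeff (trunc V f) m = (if set_mset m \<subseteq> V then mcoeff f m else 0)"
  by (simp add: trunc_def)

lemma trunc_add [simp]: "trunc V (f + g) = trunc V f + trunc V g"
  by (rule mseries_eqI) (simp add: mcoeff_trunc)

lemma trunc_const [simp]: "trunc V (mconst c) = mconst c"
  by (rule mseries_eqI) (simp add: mcoeff_trunc mcoeff_const)

lemma trunc_zero [simp]: "trunc V 0 = 0" and trunc_one [simp]: "trunc V 1 = 1"
  using trunc_const[of V 0] trunc_const[of V 1] by simp_all

lemma trunc_of_nat [simp]: "trunc V (of_nat n) = of_nat n"
  by (metis trunc_const mconst_of_nat)

lemma trunc_sum [simp]: "trunc V (sum f I) = (\<Sum>i\<in>I. trunc V (f i))"
  by (induction I rule: infinite_finite_induct) auto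

lemma trunc_mult [simp]: "trunc V (f * g) = trunc V f * trunc V g"
proof (rule mseries_eqI)
  fix m
  have "mcoeff (trunc V f * trunc V g) m =
      (\<Sum>(a, b) \<in> {(a, b). a + b = m}. if set_mset m \<subseteq> V then mcoeff f a * mcoeff g b else 0)"
    unfolding mcoeff_mult by (rule sum.cong) (auto simp: mcoeff_trunc)
  thus "mcoeff (trunc V (f * g)) m = mcoeff (trunc V f * trunc V g) m"
    by (simp add: mcoeff_trunc mcoeff_mult)
qed

lemma trunc_power [simp]: "trunc V (f ^ k) = trunc V f ^ k"
  by (induction k) auto

lemma pd_trunc: "v \<in> V \<Longrightarrow> pd v (trunc V f) = trunc V (pd v f)"
  by (rule mseries_eqI) (simp add: mcoeff_trunc mcoeff_pd)

subsection \<open>Gaussian integration by parts\<close>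

text \<open>Not normalized; \<open>s\<close> is the variance.\<close>

definition gauss_moment :: "real \<Rightarrow> nat \<Rightarrow> complex" where
  "gauss_moment s n = (LINT y | lborel. of_real (y ^ n * exp (- y\<^sup>2 / (2 * s))))"

text \<open>The recursion is read off from the closed formulas for even and odd moments of the
  normal density. For \<open>n = 0\<close> the truncated \<open>n - 1\<close> does no harm because
  of the factor \<open>n\<close>.\<close>

lemma
  assumes "s > 0"
  shows integrable_gauss_moment:
      "integrable lborel (\<lambda>y. of_real (y ^ n * exp (- y\<^sup>2 / (2 * s))) :: complex)"
    and gauss_moment_0: "gauss_moment s 0 = of_real (sqrt (2 * pi * s))"
    and gauss_moment_Suc: "gauss_moment s (Suc n) = of_real s * of_nat n * gauss_moment s (n - 1)"
proof -
  define \<sigma> where "\<sigma> = sqrt s"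
  have \<sigma>: "\<sigma> > 0" "\<sigma>\<^sup>2 = s" using assms by (auto simp: \<sigma>_def)
  define c where "c = sqrt (2 * pi * s)"
  have c: "c \<noteq> 0" using assms by (simp add: c_def)
  have eq: "y ^ n * exp (- y\<^sup>2 / (2 * s)) = c * (normal_density 0 \<sigma> y * (y - 0) ^ n)" for y n
    using c by (simp add: normal_density_def \<sigma> c_def)
  have int: "integrable lborel (\<lambda>y. y ^ n * exp (- y\<^sup>2 / (2 * s)))" for n
    unfolding eq by (intro integrable_mult_right integrable_normal_moment \<sigma>)
  thus "integrable lborel (\<lambda>y. of_real (y ^ n * exp (- y\<^sup>2 / (2 * s))) :: complex)"
    by (rule integrable_of_real)
  have mom: "gauss_moment s n = of_real (c * (LINT y | lborel. normal_density 0 \<sigma> y * (y - 0) ^ n))" for n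
    unfolding gauss_moment_def integral_complex_of_real unfolding eq by simp
  show "gauss_moment s 0 = of_real (sqrt (2 * pi * s))"
    using integral_normal_moment_even[OF \<sigma>(1), of 0 0] by (simp add: mom c_def)
  show "gauss_moment s (Suc n) = of_real s * of_nat n * gauss_moment s (n - 1)"
  proof (cases "even n")
    case True
    then obtain k where n: "n = 2 * k" by blast
    have "gauss_moment s (Suc n) = 0"
      using integral_normal_moment_odd[OF \<sigma>(1), of 0 k] by (simp add: mom n)
    moreover have "of_nat n * gauss_moment s (n - 1) = 0"
    proof (cases k)
      case (Suc j)
      hence "n - 1 = 2 * j + 1" by (simp add: n)
      thus ?thesis using integral_normal_moment_odd[OF \<sigma>(1), of 0 j] by (simp add: mom)
    qed (simp add: n)
    ultimately show ?thesis by (simp add: mult.assoc)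
  next
    case False
    then obtain k where n: "n = 2 * k + 1" by (blast elim: oddE)
    have e: "(LINT y | lborel. normal_density 0 \<sigma> y * (y - 0) ^ (2 * j)) =
        fact (2 * j) / ((2 / s) ^ j * fact j)" for j
      using integral_normal_moment_even[OF \<sigma>(1), of 0 j] by (simp add: \<sigma>)
    have "2 * a * m * F / (2 / s * P * (a * B)) = s * m * (F / (P * B))"
      if "a \<noteq> 0" for a m F P B :: real
      using assms that by (simp add: divide_simps)
    from this[of "real (Suc k)" "real n" "fact (2 * k)" "(2 / s) ^ k" "fact k"]
    have "fact (2 * Suc k) / ((2 / s) ^ Suc k * fact (Suc k)) =
        s * real n * (fact (2 * k) / ((2 / s) ^ k * fact k))"
      by (simp add: n algebra_simps)
    hence "gauss_moment s (2 * Suc k) = of_real (s * real n) * gauss_moment s (2 * k)"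
      unfolding mom e by (simp only: of_real_mult mult_ac)
    thus ?thesis by (simp add: n)
  qed
qed

locale gaussian_product =
  fixes I :: "'i set" and s :: "'i \<Rightarrow> real"
  assumes fin: "finite I" and s_pos: "s p > 0"
begin

definition weight :: "('i \<Rightarrow> real) \<Rightarrow> complex" where
  "weight x = (\<Prod>p\<in>I. of_real (exp (- (x p)\<^sup>2 / (2 * s p))))"

definition gint :: "(('i \<Rightarrow> real) \<Rightarrow> complex) \<Rightarrow> complex" where
  "gint f = (LINT x | (\<Pi>\<^sub>M p\<in>I. lborel). f x * weight x)"

definition gintegrable :: "(('i \<Rightarrow> real) \<Rightarrow> complex) \<Rightarrow> bool" where
  "gintegrable f \<longleftrightarrow> integrable (\<Pi>\<^sub>M p\<in>I. lborel) (\<lambda>x. f x * weight x)"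

definition cmon :: "'i multiset \<Rightarrow> ('i \<Rightarrow> real) \<Rightarrow> complex" where
  "cmon e x = (\<Prod>p\<in>I. of_real (x p) ^ count e p)"

lemma cmon_empty [simp]: "cmon {#} x = 1"
  by (simp add: cmon_def)

lemma cmon_add: "cmon (e + e') x = cmon e x * cmon e' x"
  by (simp add: cmon_def power_add prod.distrib)

lemma cmon_single: "q \<in> I \<Longrightarrow> cmon {#q#} x = of_real (x q)"
  using fin by (simp add: cmon_def if_distrib prod.If_cases Int_def cong: if_cong)

lemma
  shows gintegrable_cmon: "gintegrable (cmon e)"
    and gint_cmon: "gint (cmon e) = (\<Prod>p\<in>I. gauss_moment (s p) (count e p))"
proof -
  interpret product_sigma_finite "\<lambda>_ :: 'i. lborel :: real measure" ..
  have eq: "cmon e x * weight x =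
      (\<Prod>p\<in>I. of_real ((x p) ^ count e p * exp (- (x p)\<^sup>2 / (2 * s p))))" for x
    by (simp add: cmon_def weight_def prod.distrib)
  show "gintegrable (cmon e)" unfolding gintegrable_def eq
    by (rule product_integrable_prod[OF fin integrable_gauss_moment[OF s_pos]])
  show "gint (cmon e) = (\<Prod>p\<in>I. gauss_moment (s p) (count e p))"
    unfolding gint_def eq gauss_moment_def
    by (rule product_integral_prod[OF fin integrable_gauss_moment[OF s_pos]])
qed

text \<open>Only the factor of the coordinate \<open>q\<close> changes, and it obeys the recursion
  for moments. If \<open>q\<close> does not occur in \<open>e\<close>, both sides vanish.\<close>

lemma gint_cmon_step:
  assumes "q \<in> I"
  shows "gint (cmon (add_mset q e)) = of_real (s q) * of_nat (count e q) * gint (cmon (e - {#q#}))"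
proof -
  have "(\<Prod>p\<in>I - {q}. gauss_moment (s p) (count (add_mset q e) p)) =
        (\<Prod>p\<in>I - {q}. gauss_moment (s p) (count (e - {#q#}) p))"
    by (rule prod.cong) auto
  thus ?thesis
    unfolding gint_cmon prod.remove[OF fin assms] by (simp add: gauss_moment_Suc[OF s_pos])
qed

lemma gint_one_nonzero: "gint (\<lambda>_. 1) \<noteq> 0"
proof -
  have "gint (cmon {#}) = (\<Prod>p\<in>I. of_real (sqrt (2 * pi * s p)))"
    using gauss_moment_0[OF s_pos] by (simp add: gint_cmon)
  moreover have "s p \<noteq> 0" for p using s_pos[of p] by simp
  moreover have "cmon {#} = (\<lambda>_. 1)" by auto
  ultimately show ?thesis using fin by simp
qed

lemma gint_add: "gintegrable f \<Longrightarrow> gintegrable g \<Longrightarrow> gint (\<lambda>x. f x + g x) = gint f + gint g"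
  by (simp add: gintegrable_def gint_def distrib_right)

lemma gint_cmult: "gint (\<lambda>x. c * f x) = c * gint f"
  by (simp add: gint_def mult.assoc)

lemma gintegrable_zero: "gintegrable (\<lambda>x. 0)"
  by (simp add: gintegrable_def)

lemma gintegrable_add: "gintegrable f \<Longrightarrow> gintegrable g \<Longrightarrow> gintegrable (\<lambda>x. f x + g x)"
  by (simp add: gintegrable_def distrib_right)

lemma gintegrable_cmult: "gintegrable f \<Longrightarrow> gintegrable (\<lambda>x. c * f x)"
  by (simp add: gintegrable_def mult.assoc)

lemma gintegrable_sum: "(\<And>i. i \<in> A \<Longrightarrow> gintegrable (f i)) \<Longrightarrow> gintegrable (\<lambda>x. \<Sum>i\<in>A. f i x)"
  by (induction A rule: infinite_finite_induct) (auto intro: gintegrable_add simp: gintegrable_zero)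

lemma gint_sum: "(\<And>i. i \<in> A \<Longrightarrow> gintegrable (f i)) \<Longrightarrow> gint (\<lambda>x. \<Sum>i\<in>A. f i x) = (\<Sum>i\<in>A. gint (f i))"
  by (induction A rule: infinite_finite_induct)
     (auto simp: gint_add gintegrable_sum, simp_all add: gint_def)

text \<open>The derivative of \<open>cmon e\<close> in the constant complex direction
  \<open>\<delta>\<close>.\<close>

definition dcmon :: "('i \<Rightarrow> complex) \<Rightarrow> 'i multiset \<Rightarrow> ('i \<Rightarrow> real) \<Rightarrow> complex" where
  "dcmon \<delta> e x = (\<Sum>q\<in>I. \<delta> q * of_nat (count e q) * cmon (e - {#q#}) x)"

lemma dcmon_add: "dcmon \<delta> (e + e') x = dcmon \<delta> e x * cmon e' x + cmon e x * dcmon \<delta> e' x"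
proof -
  \<comment> \<open>If \<open>q\<close> occurs only in \<open>e'\<close>, the subtraction hits the
    wrong factor, but then the multiplicity in \<open>e\<close> is 0.\<close>
  have half: "of_nat (count e q) * cmon (e + e' - {#q#}) x = of_nat (count e q) * cmon (e - {#q#}) x * cmon e' x"
    for e e' q
  proof (cases "q \<in># e")
    case True
    hence "e + e' - {#q#} = e - {#q#} + e'" by auto
    thus ?thesis by (simp add: cmon_add)
  qed (simp add: not_in_iff)
  have eq: "of_nat (count (e + e') q) * cmon (e + e' - {#q#}) x =
      of_nat (count e q) * cmon (e - {#q#}) x * cmon e' x +
      cmon e x * (of_nat (count e' q) * cmon (e' - {#q#}) x)" for q
    using half[of e q e'] half[of e' q e] by (auto simp: distrib_right add.commute mult_ac)
  have "\<delta> q * of_nat (count (e + e') q) * cmon (e + e' - {#q#}) x =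
      \<delta> q * of_nat (count e q) * cmon (e - {#q#}) x * cmon e' x +
      cmon e x * (\<delta> q * of_nat (count e' q) * cmon (e' - {#q#}) x)" for q
    using arg_cong[OF eq, of "(*) (\<delta> q)" q] by (simp only: distrib_left mult_ac)
  thus ?thesis by (simp only: dcmon_def sum.distrib sum_distrib_left sum_distrib_right)
qed

text \<open>
  A polynomial in the coordinates, paired with its image under the derivation that sends the
  coordinate \<open>q\<close> to \<open>\<delta> q\<close>.
\<close>

inductive der :: "('i \<Rightarrow> complex) \<Rightarrow> (('i \<Rightarrow> real) \<Rightarrow> complex) \<Rightarrow> (('i \<Rightarrow> real) \<Rightarrow> complex) \<Rightarrow> bool"
  for \<delta> where
  zero: "der \<delta> (\<lambda>_. 0) (\<lambda>_. 0)"
| step: "der \<delta> f f' \<Longrightarrow> der \<delta> (\<lambda>x. c * cmon e x + f x) (\<lambda>x. c * dcmon \<delta> e x + f' x)"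

lemma der_cmon: "der \<delta> (\<lambda>x. c * cmon e x) (\<lambda>x. c * dcmon \<delta> e x)"
  using der.step[OF der.zero, of \<delta> c e] by simp

lemma der_const: "der \<delta> (\<lambda>_. c) (\<lambda>_. 0)"
  using der_cmon[of \<delta> c "{#}"] by (simp add: dcmon_def)

lemma der_coord:
  assumes "q \<in> I"
  shows "der \<delta> (\<lambda>x. of_real (x q)) (\<lambda>_. \<delta> q)"
proof -
  have "dcmon \<delta> {#q#} x = \<delta> q" for x
    using assms fin by (subst dcmon_def, subst sum.remove[of I q]) (auto intro!: sum.neutral split: if_splits)
  thus ?thesis using der_cmon[of \<delta> 1 "{#q#}"] assms by (simp add: cmon_single)
qed

lemma der_add: "der \<delta> f f' \<Longrightarrow> der \<delta> g g' \<Longrightarrow> der \<delta> (\<lambda>x. f x + g x) (\<lambda>x. f' x + g' x)"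
proof (induction rule: der.induct)
  case (step f f' c e)
  thus ?case using der.step[of \<delta> "\<lambda>x. f x + g x" "\<lambda>x. f' x + g' x" c e] by (simp add: add.assoc)
qed simp

lemma der_cmon_mult: "der \<delta> f f' \<Longrightarrow>
    der \<delta> (\<lambda>x. c * cmon e x * f x) (\<lambda>x. c * dcmon \<delta> e x * f x + c * cmon e x * f' x)"
proof (induction rule: der.induct)
  case zero
  thus ?case by (simp add: der.zero)
next
  case (step f f' d a)
  from der.step[OF step.IH, of "c * d" "e + a"] show ?case
    by (simp add: cmon_add dcmon_add algebra_simps)
qed

lemma der_mult: "der \<delta> f f' \<Longrightarrow> der \<delta> g g' \<Longrightarrow> der \<delta> (\<lambda>x. f x * g x) (\<lambda>x. f' x * g x + f x * g' x)"
proof (induction rule: der.induct)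
  case zero
  thus ?case by (simp add: der.zero)
next
  case (step f f' c e)
  from der_add[OF der_cmon_mult[OF step.prems, of c e] step.IH[OF step.prems]] show ?case
    by (simp add: algebra_simps)
qed

lemma der_cmult: "der \<delta> f f' \<Longrightarrow> der \<delta> (\<lambda>x. c * f x) (\<lambda>x. c * f' x)"
  using der_mult[OF der_const, of \<delta> f f' c] by simp

lemma der_sum: "(\<And>i. i \<in> A \<Longrightarrow> der \<delta> (f i) (f' i)) \<Longrightarrow> der \<delta> (\<lambda>x. \<Sum>i\<in>A. f i x) (\<lambda>x. \<Sum>i\<in>A. f' i x)"
  by (induction A rule: infinite_finite_induct) (auto intro: der_add der.zero)

lemma gintegrable_der: "der \<delta> f f' \<Longrightarrow> gintegrable f"
  by (induction rule: der.induct)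
     (auto intro!: gintegrable_add gintegrable_cmult gintegrable_cmon gintegrable_zero)

text \<open>By linearity this reduces to \<open>gint_cmon_step\<close>. The linear form is dual to
  \<open>\<delta>\<close> with respect to the variances; below, \<open>\<delta>\<close> is chosen
  such that the form is a matrix entry.\<close>

lemma
  assumes "der \<delta> f f'"
  shows stein: "gint (\<lambda>x. (\<Sum>q\<in>I. \<delta> q / of_real (s q) * of_real (x q)) * f x) = gint f'"
    and gintegrable_stein: "gintegrable (\<lambda>x. (\<Sum>q\<in>I. \<delta> q / of_real (s q) * of_real (x q)) * f x)"
    and gintegrable_der': "gintegrable f'"
proof -
  define l :: "('i \<Rightarrow> real) \<Rightarrow> complex" where "l x = (\<Sum>q\<in>I. \<delta> q / of_real (s q) * of_real (x q))" for x
  have lm: "l x * cmon e x = (\<Sum>q\<in>I. \<delta> q / of_real (s q) * cmon (add_mset q e) x)" for e x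
  proof -
    have "cmon (add_mset q e) x = of_real (x q) * cmon e x" if "q \<in> I" for q
      using cmon_add[of "{#q#}" e x] that by (simp add: cmon_single)
    thus ?thesis by (simp add: l_def sum_distrib_right mult.assoc)
  qed
  have l_int: "gintegrable (\<lambda>x. l x * cmon e x)" for e
    unfolding lm by (intro gintegrable_sum gintegrable_cmult gintegrable_cmon)
  have d_int: "gintegrable (\<lambda>x. dcmon \<delta> e x)" for e
    unfolding dcmon_def by (intro gintegrable_sum gintegrable_cmult gintegrable_cmon)
  have cmon: "gint (\<lambda>x. l x * cmon e x) = gint (\<lambda>x. dcmon \<delta> e x)" for e
  proof -
    have "gint (\<lambda>x. l x * cmon e x) = (\<Sum>q\<in>I. \<delta> q / of_real (s q) * gint (cmon (add_mset q e)))"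
      unfolding lm by (simp only: gint_sum gintegrable_cmult gintegrable_cmon gint_cmult)
    also have "\<dots> = (\<Sum>q\<in>I. \<delta> q * of_nat (count e q) * gint (cmon (e - {#q#})))"
    proof (rule sum.cong[OF refl])
      fix q assume "q \<in> I"
      thus "\<delta> q / of_real (s q) * gint (cmon (add_mset q e)) =
          \<delta> q * of_nat (count e q) * gint (cmon (e - {#q#}))"
        using s_pos[of q] by (simp add: gint_cmon_step)
    qed
    also have "\<dots> = gint (\<lambda>x. dcmon \<delta> e x)"
      unfolding dcmon_def by (simp add: gint_sum gintegrable_cmult gintegrable_cmon gint_cmult)
    finally show ?thesis .
  qed
  from assms have *: "gintegrable (\<lambda>x. l x * f x) \<and> gintegrable f' \<and> gint (\<lambda>x. l x * f x) = gint f'"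
  proof (induction rule: der.induct)
    case zero
    show ?case by (simp add: gintegrable_zero)
  next
    case (step f f' c e)
    have eq: "l x * (c * cmon e x + f x) = c * (l x * cmon e x) + l x * f x" for x
      by (simp add: algebra_simps)
    show ?case unfolding eq using step.IH
      by (simp add: gintegrable_add gintegrable_cmult gint_add gint_cmult l_int d_int cmon)
  qed
  show "gint (\<lambda>x. (\<Sum>q\<in>I. \<delta> q / of_real (s q) * of_real (x q)) * f x) = gint f'"
    "gintegrable (\<lambda>x. (\<Sum>q\<in>I. \<delta> q / of_real (s q) * of_real (x q)) * f x)" "gintegrable f'"
    using * by (simp_all add: l_def)
qed

end

subsection \<open>The Gaussian unitary ensemble\<close>

text \<open>
  The operator \<open>(n / N\<^sup>2) d/da(n)\<close>, which inserts a factor \<open>Tr(M\<^sup>n) / N\<close> into the mean; for \<open>n = 0\<close> this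
  factor is 1.
\<close>

definition var_op :: "nat \<Rightarrow> nat \<Rightarrow> complex aseries \<Rightarrow> complex aseries" where
  "var_op N n f = (if n = 0 then f else mconst (of_nat n / (of_nat N)\<^sup>2) * pd (n - 1) f)"

locale gue =
  fixes N :: nat
  assumes N_pos: "N \<ge> 1"

text \<open>Half the trace of the squared matrix is the sum of half the squares of the diagonal
  coordinates and the full squares of the others; with the factor \<open>N\<close> this gives the
  two variances.\<close>

sublocale gue \<subseteq> gaussian_product "{..<N} \<times> {..<N}" "\<lambda>(i, j). if i = j then 1 / real N else 1 / (2 * real N)"
  by unfold_locales (use N_pos in auto)

context gue
begin

abbreviation s :: "nat \<times> nat \<Rightarrow> real" where
  "s \<equiv> \<lambda>(i, j). if i = j then 1 / real N else 1 / (2 * real N)"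

definition entry :: "nat \<Rightarrow> nat \<Rightarrow> nat \<Rightarrow> (nat \<times> nat \<Rightarrow> real) \<Rightarrow> complex" where
  "entry k i j x = (herm N x ^\<^sub>m k) $$ (i, j)"

definition tr :: "nat \<Rightarrow> (nat \<times> nat \<Rightarrow> real) \<Rightarrow> complex" where
  "tr k x = mtrace (herm N x ^\<^sub>m k)"

lemma herm_carrier [simp]: "herm N x \<in> carrier_mat N N"
  by (simp add: herm_def)

lemma dim_herm [simp]: "dim_row (herm N x) = N" "dim_col (herm N x) = N"
  by (simp_all add: herm_def)

lemma entry_0: "i < N \<Longrightarrow> j < N \<Longrightarrow> entry 0 i j x = (if i = j then 1 else 0)"
  by (simp add: entry_def)

lemma entry_Suc:
  assumes "i < N" "j < N"
  shows "entry (Suc k) i j x = (\<Sum>l<N. entry k i l x * entry 1 l j x)"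
proof -
  have "entry (Suc k) i j x = row (herm N x ^\<^sub>m k) i \<bullet> col (herm N x) j"
    using assms by (simp add: entry_def)
  also have "\<dots> = (\<Sum>l<N. entry k i l x * entry 1 l j x)"
    using assms by (simp add: scalar_prod_def entry_def atLeast0LessThan)
  finally show ?thesis .
qed

lemma entry_add:
  assumes "i < N" "j < N"
  shows "(\<Sum>l<N. entry k i l x * entry k' l j x) = entry (k + k') i j x"
  using assms
proof (induction k' arbitrary: j)
  case 0
  thus ?case by (simp add: entry_0 if_distrib cong: if_cong)
next
  case (Suc k')
  have "(\<Sum>l<N. entry k i l x * entry (Suc k') l j x) =
      (\<Sum>l<N. \<Sum>l'<N. entry k i l x * entry k' l l' x * entry 1 l' j x)"
    using Suc.prems by (simp add: entry_Suc[of _ j k'] sum_distrib_left mult.assoc)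
  also have "\<dots> = (\<Sum>l'<N. (\<Sum>l<N. entry k i l x * entry k' l l' x) * entry 1 l' j x)"
    by (subst sum.swap) (simp add: sum_distrib_right)
  also have "\<dots> = entry (k + Suc k') i j x"
    using Suc by (simp add: entry_Suc[of _ j "k + k'"])
  finally show ?case .
qed

lemma tr_eq: "tr k x = (\<Sum>i<N. entry k i i x)"
  by (simp add: tr_def mtrace_def entry_def)

lemma tr_0: "tr 0 x = of_nat N"
  by (simp add: tr_eq entry_0)

lemma entry_1: "i < N \<Longrightarrow> j < N \<Longrightarrow> entry 1 i j x =
    (if i = j then of_real (x (i, i))
     else if i < j then of_real (x (i, j)) + \<i> * of_real (x (j, i))
     else of_real (x (j, i)) - \<i> * of_real (x (i, j)))"
  by (simp add: entry_def herm_def complex_eq_iff)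

lemmas entry_Suc_0 = entry_1[unfolded One_nat_def]

lemma gauss_weight_eq: "gauss_weight N (herm N x) = weight x"
proof -
  \<comment> \<open>\<open>h i j\<close> is the share of the coordinate \<open>x (i, j)\<close> in
    half the trace of the squared matrix. The squared modulus of an off-diagonal entry involves two
    coordinates, whence \<open>h i j + h j i\<close>.\<close>
  define h :: "nat \<Rightarrow> nat \<Rightarrow> complex" where
    "h i j = (if i = j then of_real ((x (i, i))\<^sup>2 / 2) else of_real ((x (i, j))\<^sup>2))" for i j
  have sq: "entry 1 i j x * entry 1 j i x = h i j + h j i" if "i < N" "j < N" for i j
    using that by (cases i j rule: linorder_cases)
      (auto simp: entry_Suc_0 h_def algebra_simps power2_eq_square)
  have "mtrace ((1 / 2) \<cdot>\<^sub>m (herm N x ^\<^sub>m 2)) = (1 / 2) * tr 2 x"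
    by (simp add: mtrace_def tr_def sum_distrib_left)
  also have "tr 2 x = (\<Sum>i<N. \<Sum>j<N. h i j + h j i)"
    unfolding tr_eq numeral_2_eq_2
    by (intro sum.cong refl, subst entry_Suc) (auto intro!: sum.cong simp flip: sq One_nat_def)
  also have "\<dots> = 2 * (\<Sum>i<N. \<Sum>j<N. h i j)"
    unfolding sum.distrib by (subst (2) sum.swap) simp
  finally have "gauss_weight N (herm N x) = exp (\<Sum>i<N. \<Sum>j<N. - of_nat N * h i j)"
    by (simp add: gauss_weight_def sum_distrib_left sum_negf)
  also have "(\<Sum>i<N. \<Sum>j<N. - of_nat N * h i j) =
      (\<Sum>p\<in>{..<N} \<times> {..<N}. of_real (- (x p)\<^sup>2 / (2 * s p)))"
    unfolding sum.cartesian_product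
    by (rule sum.cong) (auto simp: h_def)
  also have "exp \<dots> = weight x"
    unfolding weight_def
    by (simp only: exp_sum finite_cartesian_product finite_lessThan exp_of_real)
  finally show ?thesis .
qed

text \<open>The derivation \<open>N\<^sup>-\<^sup>1 \<partial> / \<partial>M\<^sub>b\<^sub>a\<close>, which is dual to multiplication by the entry at (a, b).\<close>

definition edir :: "nat \<Rightarrow> nat \<Rightarrow> nat \<times> nat \<Rightarrow> complex" where
  "edir a b q = of_real (s q) *
     (if a = b then if q = (a, a) then 1 else 0
      else if a < b then if q = (a, b) then 1 else if q = (b, a) then \<i> else 0
      else if q = (b, a) then 1 else if q = (a, b) then - \<i> else 0)"

lemma entry_edir:
  assumes "a < N" "b < N"
  shows "(\<Sum>q\<in>{..<N} \<times> {..<N}. edir a b q / of_real (s q) * of_real (x q)) = entry 1 a b x"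
proof -
  have eq: "edir a b q / of_real (s q) =
     (if a = b then if q = (a, a) then 1 else 0
      else if a < b then if q = (a, b) then 1 else if q = (b, a) then \<i> else 0
      else if q = (b, a) then 1 else if q = (a, b) then - \<i> else 0)" for q
    using s_pos[of q] by (simp add: edir_def)
  have "(\<Sum>q\<in>{..<N} \<times> {..<N}. edir a b q / of_real (s q) * of_real (x q)) =
      (\<Sum>q\<in>{(a, b), (b, a)}. edir a b q / of_real (s q) * of_real (x q))"
    unfolding eq by (rule sum.mono_neutral_right) (use assms in auto)
  also have "\<dots> = entry 1 a b x"
    unfolding eq entry_1[OF assms] by (cases "a = b") auto
  finally show ?thesis .
qed

text \<open>The constant is the propagator, the mean of the product of the entries at (a, b) and (c,
  d). Off the diagonal, real and imaginary part contribute \<open>1 / (2 N)\<close> each in absolute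
  value, and these add up or cancel.\<close>

lemma der_entry_1:
  assumes "a < N" "b < N" "c < N" "d < N"
  shows "der (edir a b) (entry 1 c d) (\<lambda>_. if c = b \<and> d = a then 1 / of_nat N else 0)"
proof (cases "c = d")
  case True
  have "entry 1 c d = (\<lambda>x. of_real (x (c, c)))" using assms True by (simp add: entry_Suc_0 fun_eq_iff)
  moreover have "edir a b (c, c) = (if c = b \<and> d = a then 1 / of_nat N else 0)"
    using True by (auto simp: edir_def)
  ultimately show ?thesis using der_coord[of "(c, c)" "edir a b"] assms by simp
next
  case False
  \<comment> \<open>The coordinates of the real part and, up to sign, of the imaginary part of the
    entry; \<open>e\<close> is the coefficient of the latter.\<close>
  define p q and e :: complex where "p = (min c d, max c d)" and "q = (max c d, min c d)"
    and "e = (if c < d then \<i> else - \<i>)"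
  have pq: "p \<in> {..<N} \<times> {..<N}" "q \<in> {..<N} \<times> {..<N}" using assms by (auto simp: p_def q_def)
  have "der (edir a b) (\<lambda>x. of_real (x p) + e * of_real (x q)) (\<lambda>_. edir a b p + e * edir a b q)"
    by (intro der_add der_cmult der_coord pq)
  moreover have "(\<lambda>x. of_real (x p) + e * of_real (x q)) = entry 1 c d"
    using assms False by (auto simp: fun_eq_iff entry_Suc_0 p_def q_def e_def)
  moreover have "edir a b p + e * edir a b q = (if c = b \<and> d = a then 1 / of_nat N else 0)"
  proof (cases "c < d")
    case True
    hence "p = (c, d)" "q = (d, c)" "e = \<i>" by (auto simp: p_def q_def e_def)
    thus ?thesis using True by (cases a b rule: linorder_cases) (auto simp: edir_def)
  next
    case ge: False
    hence "p = (d, c)" "q = (c, d)" "e = - \<i>" "d < c" using False by (auto simp: p_def q_def e_def)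
    thus ?thesis by (cases a b rule: linorder_cases) (auto simp: edir_def)
  qed
  ultimately show ?thesis by simp
qed

text \<open>Product rule: hitting the factor at position \<open>j\<close> leaves the power
  \<open>j\<close> on its left and \<open>k - 1 - j\<close> on its right, with the indices crossed
  as in \<open>der_entry_1\<close>.\<close>

lemma der_entry:
  assumes "a < N" "b < N" "c < N" "d < N"
  shows "der (edir a b) (entry k c d)
           (\<lambda>x. \<Sum>j<k. entry j c b x * entry (k - 1 - j) a d x / of_nat N)"
  using assms(3,4)
proof (induction k arbitrary: d)
  case 0
  thus ?case using der_const[of _ "if c = d then 1 else 0"] by (simp add: entry_0 fun_eq_iff)
next
  case (Suc k)
  have "der (edir a b) (\<lambda>x. \<Sum>l<N. entry k c l x * entry 1 l d x)
      (\<lambda>x. \<Sum>l<N. (\<Sum>j<k. entry j c b x * entry (k - 1 - j) a l x / of_nat N) * entry 1 l d x +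
         entry k c l x * (if l = b \<and> d = a then 1 / of_nat N else 0))"
    by (intro der_sum der_mult Suc.IH der_entry_1) (use assms Suc.prems in auto)
  moreover have "(\<lambda>x. \<Sum>l<N. entry k c l x * entry 1 l d x) = entry (Suc k) c d"
    by (intro ext entry_Suc[symmetric]) (use Suc.prems in auto)
  moreover have "(\<Sum>l<N. (\<Sum>j<k. entry j c b x * entry (k - 1 - j) a l x / of_nat N) * entry 1 l d x +
         entry k c l x * (if l = b \<and> d = a then 1 / of_nat N else 0)) =
      (\<Sum>j<Suc k. entry j c b x * entry (Suc k - 1 - j) a d x / of_nat N)" for x
  proof -
    have "(\<Sum>l<N. (\<Sum>j<k. entry j c b x * entry (k - 1 - j) a l x / of_nat N) * entry 1 l d x) =
        (\<Sum>j<k. entry j c b x / of_nat N * (\<Sum>l<N. entry (k - 1 - j) a l x * entry 1 l d x))"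
      unfolding sum_distrib_left sum_distrib_right by (subst sum.swap) (simp add: mult_ac)
    also have "\<dots> = (\<Sum>j<k. entry j c b x * entry (Suc k - 1 - j) a d x / of_nat N)"
    proof (rule sum.cong[OF refl])
      fix j assume "j \<in> {..<k}"
      hence "(\<Sum>l<N. entry (k - 1 - j) a l x * entry 1 l d x) = entry (Suc k - 1 - j) a d x"
        using entry_add[of a d "k - 1 - j" x 1] assms Suc.prems by (simp add: Suc_diff_Suc)
      thus "entry j c b x / of_nat N * (\<Sum>l<N. entry (k - 1 - j) a l x * entry 1 l d x) =
          entry j c b x * entry (Suc k - 1 - j) a d x / of_nat N" by simp
    qed
    finally have 1: "(\<Sum>l<N. (\<Sum>j<k. entry j c b x * entry (k - 1 - j) a l x / of_nat N) * entry 1 l d x) =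
        (\<Sum>j<k. entry j c b x * entry (Suc k - 1 - j) a d x / of_nat N)" .
    have "(\<Sum>l<N. entry k c l x * (if l = b \<and> d = a then 1 / of_nat N else 0)) =
        (\<Sum>l<N. if l = b then entry k c l x * (if d = a then 1 / of_nat N else 0) else 0)"
      by (rule sum.cong) auto
    also have "\<dots> = entry k c b x * entry 0 a d x / of_nat N"
      using assms Suc.prems by (simp add: entry_0)
    finally show ?thesis unfolding sum.distrib 1 by simp
  qed
  ultimately show ?case by simp
qed

text \<open>Under the trace the two pieces of every cut recombine to the same power, once for each
  of the \<open>k\<close> positions.\<close>

lemma der_tr:
  assumes "a < N" "b < N"
  shows "der (edir a b) (tr k) (\<lambda>x. of_nat k / of_nat N * entry (k - 1) a b x)"
proof -
  have "der (edir a b) (\<lambda>x. \<Sum>c<N. entry k c c x)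
      (\<lambda>x. \<Sum>c<N. \<Sum>j<k. entry j c b x * entry (k - 1 - j) a c x / of_nat N)"
    by (intro der_sum der_entry) (use assms in auto)
  moreover have "(\<Sum>c<N. \<Sum>j<k. entry j c b x * entry (k - 1 - j) a c x / of_nat N) =
      of_nat k / of_nat N * entry (k - 1) a b x" for x
  proof -
    have "(\<Sum>c<N. \<Sum>j<k. entry j c b x * entry (k - 1 - j) a c x / of_nat N) =
        (\<Sum>j<k. (\<Sum>c<N. entry (k - 1 - j) a c x * entry j c b x) / of_nat N)"
      by (subst sum.swap) (simp add: sum_divide_distrib mult.commute)
    also have "\<dots> = (\<Sum>j<k. entry (k - 1) a b x / of_nat N)"
      using assms by (intro sum.cong) (auto simp: entry_add)
    finally show ?thesis by simp
  qed
  ultimately show ?thesis by (simp add: tr_eq fun_eq_iff cong: arg_cong2[of _ _ _ _ der] flip: tr_eq)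
qed

definition J :: "(nat \<times> nat \<Rightarrow> real) \<Rightarrow> complex aseries" where
  "J x = interaction N (herm N x)"

lemma mcoeff_action:
  "mcoeff (msum (\<lambda>n. avar n * mconst (c n)) {1..}) m =
     (if \<exists>v. m = {#v#} then c (Suc (THE v. m = {#v#})) else 0)"
  for c :: "nat \<Rightarrow> complex"
proof (cases "\<exists>v. m = {#v#}")
  case True
  then obtain v where m: "m = {#v#}" by blast
  have "mcoeff (msum (\<lambda>n. avar n * mconst (c n)) {1..}) m =
      (\<Sum>n\<in>{Suc v}. mcoeff (avar n * mconst (c n)) m)"
    by (rule mcoeff_msum) (auto simp: avar_def mcoeff_var m)
  thus ?thesis by (simp add: m avar_def mcoeff_var)
next
  case False
  have "mcoeff (msum (\<lambda>n. avar n * mconst (c n)) {1..}) m =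
      (\<Sum>n\<in>{}. mcoeff (avar n * mconst (c n)) m)"
    by (rule mcoeff_msum) (use False in \<open>auto simp: avar_def mcoeff_var\<close>)
  thus ?thesis using False by simp
qed

lemma J_empty: "mcoeff (J x) {#} = 1"
  unfolding J_def interaction_def by (intro mcoeff_mexp_empty) (simp add: mcoeff_action[unfolded One_nat_def])

lemma pd_J: "pd v (J x) = mconst (of_nat N / of_nat (Suc v) * tr (Suc v) x) * J x"
proof -
  define c where "c n = 1 / of_nat n * tr n x" for n
  have "pd v (msum (\<lambda>n. avar n * mconst (c n)) {1..}) = mconst (c (Suc v))"
    by (rule mseries_eqI) (auto simp: mcoeff_pd mcoeff_action[unfolded One_nat_def] mcoeff_const)
  thus ?thesis
    unfolding J_def interaction_def
    by (subst pd_mexp) (simp_all add: mcoeff_action[unfolded One_nat_def] c_def mult_ac flip: mconst_mult tr_def)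
qed

lemma J_step:
  "of_nat (Suc (count m v)) * mcoeff (J x) (add_mset v m) =
   of_nat N / of_nat (Suc v) * tr (Suc v) x * mcoeff (J x) m"
  using arg_cong[OF pd_J[of v x], of "\<lambda>f. mcoeff f m"] by (simp add: mcoeff_pd del: of_nat_Suc)

lemma var_op_J: "var_op N n (J x) = mconst (tr n x / of_nat N) * J x"
proof (cases n)
  case 0
  thus ?thesis using N_pos by (simp add: var_op_def tr_0)
next
  case (Suc v)
  have "of_nat (Suc v) / (of_nat N)\<^sup>2 * (of_nat N / of_nat (Suc v) * tr (Suc v) x) = tr (Suc v) x / of_nat N"
    using N_pos by (simp add: field_simps power2_eq_square del: of_nat_Suc)
  thus ?thesis unfolding Suc by (simp add: var_op_def pd_J mult.assoc[symmetric] del: of_nat_Suc flip: mconst_mult)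
qed

text \<open>The exponent of the interaction is the sum of \<open>N a(n) Tr(M^n) / n\<close>, so by
  \<open>der_tr\<close> the derivation produces \<open>a(v + 1)\<close> times an entry of
  \<open>M^v\<close>; on coefficients this removes one \<open>v\<close>. The induction adds a
  variable by \<open>J_step\<close>, which divides by its new exponent \<open>k\<close>.\<close>

lemma der_J:
  assumes "a < N" "b < N"
  shows "der (edir a b) (\<lambda>x. mcoeff (J x) m)
           (\<lambda>x. \<Sum>v\<in>set_mset m. entry v a b x * mcoeff (J x) (m - {#v#}))"
proof (induction m)
  case empty
  thus ?case by (simp add: J_empty der_const)
next
  case (add v m)
  define y where "y = (\<lambda>x. of_nat N / of_nat (Suc v) * tr (Suc v) x)"
  define k :: complex where "k = of_nat (Suc (count m v))"
  have k: "k \<noteq> 0" unfolding k_def by (simp del: of_nat_Suc)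
  have y: "der (edir a b) y (entry v a b)"
  proof -
    define c :: complex where "c = of_nat N / of_nat (Suc v)"
    have "der (edir a b) (\<lambda>x. c * tr (Suc v) x) (\<lambda>x. c * (of_nat (Suc v) / of_nat N * entry (Suc v - 1) a b x))"
      by (intro der_cmult der_tr assms)
    moreover have "(\<lambda>x. c * (of_nat (Suc v) / of_nat N * entry (Suc v - 1) a b x)) = entry v a b"
      using N_pos by (simp add: c_def fun_eq_iff del: of_nat_Suc)
    ultimately show ?thesis unfolding y_def c_def by simp
  qed
  have J: "mcoeff (J x) (add_mset v m) = 1 / k * (y x * mcoeff (J x) m)" for x
    using J_step[of m v x] k by (simp add: k_def y_def field_simps del: of_nat_Suc)
  have "der (edir a b) (\<lambda>x. mcoeff (J x) (add_mset v m))
      (\<lambda>x. 1 / k * (entry v a b x * mcoeff (J x) m +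
         y x * (\<Sum>u\<in>set_mset m. entry u a b x * mcoeff (J x) (m - {#u#}))))"
    unfolding J by (intro der_cmult der_mult y add)
  moreover have "1 / k * (entry v a b x * mcoeff (J x) m +
         y x * (\<Sum>u\<in>set_mset m. entry u a b x * mcoeff (J x) (m - {#u#}))) =
      (\<Sum>u\<in>set_mset (add_mset v m). entry u a b x * mcoeff (J x) (add_mset v m - {#u#}))" for x
  proof -
    define j where "j n = mcoeff (J x) n" for n
    \<comment> \<open>Removing some \<open>u\<close> other than \<open>v\<close> leaves the exponent
      of \<open>v\<close> unchanged, so \<open>J_step\<close> trades \<open>y x\<close> for
      \<open>k\<close>.\<close>
    have rest: "y x * (\<Sum>u\<in>set_mset m - {v}. entry u a b x * j (m - {#u#})) =
        k * (\<Sum>u\<in>set_mset m - {v}. entry u a b x * j (add_mset v m - {#u#}))"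
      unfolding sum_distrib_left
    proof (rule sum.cong[OF refl])
      fix u assume u: "u \<in> set_mset m - {v}"
      hence "k * j (add_mset v m - {#u#}) = y x * j (m - {#u#})"
        using J_step[of "m - {#u#}" v x] by (auto simp: k_def y_def j_def)
      thus "y x * (entry u a b x * j (m - {#u#})) = k * (entry u a b x * j (add_mset v m - {#u#}))"
        by (simp add: mult_ac)
    qed
    show ?thesis
    proof (cases "v \<in># m")
      case False
      hence "set_mset m - {v} = set_mset m" "k = 1" by (auto simp: k_def not_in_iff)
      moreover have "set_mset (add_mset v m) - {v} = set_mset m" using False by auto
      ultimately show ?thesis
        using rest False by (simp flip: j_def)
    next
      case True
      \<comment> \<open>Here the exponent of \<open>v\<close> is one smaller. The deficit is made up
        by the term from the derivative of \<open>y\<close>.\<close>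
      have yv: "y x * j (m - {#v#}) = (k - 1) * j m"
        using J_step[of "m - {#v#}" v x] True by (simp add: k_def y_def j_def)
      have "y x * (\<Sum>u\<in>set_mset m. entry u a b x * j (m - {#u#})) =
          entry v a b x * (y x * j (m - {#v#})) + y x * (\<Sum>u\<in>set_mset m - {v}. entry u a b x * j (m - {#u#}))"
        using True by (simp add: sum.remove[of "set_mset m" v] algebra_simps)
      also have "\<dots> = (k - 1) * entry v a b x * j m +
          k * (\<Sum>u\<in>set_mset m - {v}. entry u a b x * j (add_mset v m - {#u#}))"
        unfolding yv rest by simp
      also have "\<dots> = k * (\<Sum>u\<in>set_mset (add_mset v m). entry u a b x * j (add_mset v m - {#u#})) - entry v a b x * j m"
        using True by (simp add: sum.remove[of "set_mset m" v] insert_absorb algebra_simps)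
      finally show ?thesis using k by (simp add: field_simps flip: j_def)
    qed
  qed
  ultimately show ?case by simp
qed

subsection \<open>The loop equations\<close>

definition gexp :: "((nat \<times> nat \<Rightarrow> real) \<Rightarrow> complex) \<Rightarrow> complex" where
  "gexp f = gint f / gint (\<lambda>_. 1)"

definition gexp_series :: "((nat \<times> nat \<Rightarrow> real) \<Rightarrow> complex aseries) \<Rightarrow> complex aseries" where
  "gexp_series F = Abs_mseries (\<lambda>m. gexp (\<lambda>x. mcoeff (F x) m))"

lemma gexp_cmult: "gexp (\<lambda>x. c * f x) = c * gexp f"
  by (simp add: gexp_def gint_cmult)

lemma partition_series_eq: "partition_series N = gexp_series J"
  unfolding partition_series_def gexp_series_def gauss_mean_def gexp_def gint_def gauss_weight_eq
  by (simp add: herm_lebesgue_def J_def)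

lemma partition_series_empty: "mcoeff (partition_series N) {#} = 1"
  using gint_one_nonzero by (simp add: partition_series_eq gexp_series_def J_empty gexp_def)

lemma var_op_gexp_series: "var_op N n (gexp_series F) = gexp_series (\<lambda>x. var_op N n (F x))"
proof (cases "n = 0")
  case False
  have "mcoeff (var_op N n f) m =
      of_nat n / (of_nat N)\<^sup>2 * of_nat (Suc (count m (n - 1))) * mcoeff f (add_mset (n - 1) m)" for f m
    using False by (simp add: var_op_def mcoeff_pd del: of_nat_Suc)
  thus ?thesis
    by (intro mseries_eqI) (simp only: gexp_series_def mcoeff_Abs gexp_cmult)
qed (simp add: var_op_def)

text \<open>The trace is a sum of products of the entry of \<open>M\<close> at (a, b) and that of
  \<open>M^k\<close> at (b, a); the first is integrated by parts. The derivative of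
  \<open>M^k\<close> splits the trace in two, that of the interaction lengthens it.\<close>

lemma schwinger_dyson:
  "gint (\<lambda>x. tr (Suc k) x * mcoeff (J x) m) =
     (\<Sum>j<k. 1 / of_nat N * gint (\<lambda>x. tr j x * tr (k - 1 - j) x * mcoeff (J x) m)) +
     (\<Sum>v\<in>set_mset m. gint (\<lambda>x. tr (k + v) x * mcoeff (J x) (m - {#v#})))"
proof -
  let ?I = "{..<N} \<times> {..<N}"
  \<comment> \<open>The index 0 gives some direction of differentiation; this is only to know that
    traces and \<open>J\<close> are polynomials, hence integrable.\<close>
  have z: "0 < N" using N_pos by simp
  note tr0 = der_tr[OF z z] and J0 = der_J[OF z z]
  have int1: "gintegrable (\<lambda>x. tr n x * mcoeff (J x) m)" for n m
    by (rule gintegrable_der[OF der_mult[OF tr0 J0]])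
  have int2: "gintegrable (\<lambda>x. tr n x * tr l x * mcoeff (J x) m)" for n l m
    by (rule gintegrable_der[OF der_mult[OF der_mult[OF tr0 tr0] J0]])
  define f where "f = (\<lambda>(a, b) x. entry k b a x * mcoeff (J x) m)"
  define f' where "f' = (\<lambda>(a, b) x.
    (\<Sum>j<k. entry j b b x * entry (k - 1 - j) a a x / of_nat N) * mcoeff (J x) m +
    entry k b a x * (\<Sum>v\<in>set_mset m. entry v a b x * mcoeff (J x) (m - {#v#})))"
  have der: "der (edir (fst p) (snd p)) (f p) (f' p)" if "p \<in> ?I" for p
  proof -
    from that obtain a b where p: "p = (a, b)" "a < N" "b < N" by auto
    show ?thesis unfolding p(1) f_def f'_def prod.case fst_conv snd_conv
      by (intro der_mult der_entry der_J p)
  qed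
  have st: "gint (\<lambda>x. entry 1 (fst p) (snd p) x * f p x) = gint (f' p)"
    and st_int: "gintegrable (\<lambda>x. entry 1 (fst p) (snd p) x * f p x)" "gintegrable (f' p)" if "p \<in> ?I" for p
    using stein[OF der[OF that]] gintegrable_stein[OF der[OF that]] gintegrable_der'[OF der[OF that]] that
    by (auto simp only: entry_edir mem_Times_iff lessThan_iff)
  have "tr (Suc k) x * mcoeff (J x) m = (\<Sum>p\<in>?I. entry 1 (fst p) (snd p) x * f p x)" for x
  proof -
    have "tr (Suc k) x = (\<Sum>a<N. \<Sum>b<N. entry 1 a b x * entry k b a x)"
      using entry_add[of _ _ 1 x k] by (simp add: tr_eq)
    thus ?thesis by (simp add: f_def case_prod_unfold sum.cartesian_product sum_distrib_right mult.assoc)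
  qed
  hence "gint (\<lambda>x. tr (Suc k) x * mcoeff (J x) m) = gint (\<lambda>x. \<Sum>p\<in>?I. f' p x)"
    using st st_int by (simp add: gint_sum)
  also have "(\<lambda>x. \<Sum>p\<in>?I. f' p x) =
    (\<lambda>x. (\<Sum>j<k. 1 / of_nat N * (tr j x * tr (k - 1 - j) x * mcoeff (J x) m)) +
      (\<Sum>v\<in>set_mset m. tr (k + v) x * mcoeff (J x) (m - {#v#})))"
  proof
    fix x
    have "(\<Sum>a<N. \<Sum>b<N. (\<Sum>j<k. entry j b b x * entry (k - 1 - j) a a x / of_nat N) * mcoeff (J x) m) =
        (\<Sum>j<k. 1 / of_nat N * (tr j x * tr (k - 1 - j) x * mcoeff (J x) m))"
    proof -
      have "(\<Sum>a<N. \<Sum>b<N. (\<Sum>j<k. entry j b b x * entry (k - 1 - j) a a x / of_nat N) * mcoeff (J x) m) =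
          (\<Sum>a<N. \<Sum>j<k. \<Sum>b<N. entry j b b x * entry (k - 1 - j) a a x / of_nat N * mcoeff (J x) m)"
        unfolding sum_distrib_right by (intro sum.cong refl sum.swap)
      also have "\<dots> = (\<Sum>j<k. \<Sum>a<N. \<Sum>b<N. entry j b b x * entry (k - 1 - j) a a x / of_nat N * mcoeff (J x) m)"
        by (rule sum.swap)
      also have "\<dots> = (\<Sum>j<k. 1 / of_nat N * (tr j x * tr (k - 1 - j) x * mcoeff (J x) m))"
      proof (rule sum.cong[OF refl])
        fix j
        have "tr (k - 1 - j) x * tr j x = (\<Sum>a<N. \<Sum>b<N. entry (k - 1 - j) a a x * entry j b b x)"
          by (simp add: tr_eq sum_product)
        hence "1 / of_nat N * (tr j x * tr (k - 1 - j) x * mcoeff (J x) m) =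
            (\<Sum>a<N. \<Sum>b<N. 1 / of_nat N * (entry (k - 1 - j) a a x * entry j b b x * mcoeff (J x) m))"
          by (simp only: mult.commute[of "tr j x"] sum_distrib_left sum_distrib_right)
        thus "(\<Sum>a<N. \<Sum>b<N. entry j b b x * entry (k - 1 - j) a a x / of_nat N * mcoeff (J x) m) =
            1 / of_nat N * (tr j x * tr (k - 1 - j) x * mcoeff (J x) m)"
          by (simp add: mult_ac)
      qed
      finally show ?thesis .
    qed
    moreover have "(\<Sum>a<N. \<Sum>b<N. entry k b a x * (\<Sum>v\<in>set_mset m. entry v a b x * mcoeff (J x) (m - {#v#}))) =
        (\<Sum>v\<in>set_mset m. tr (k + v) x * mcoeff (J x) (m - {#v#}))"
    proof -
      have "(\<Sum>a<N. \<Sum>b<N. entry k b a x * (\<Sum>v\<in>set_mset m. entry v a b x * mcoeff (J x) (m - {#v#}))) =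
          (\<Sum>b<N. \<Sum>a<N. \<Sum>v\<in>set_mset m. entry k b a x * entry v a b x * mcoeff (J x) (m - {#v#}))"
        by (subst sum.swap) (simp add: sum_distrib_left mult.assoc)
      also have "\<dots> = (\<Sum>b<N. \<Sum>v\<in>set_mset m. \<Sum>a<N. entry k b a x * entry v a b x * mcoeff (J x) (m - {#v#}))"
        by (intro sum.cong refl sum.swap)
      also have "\<dots> = (\<Sum>b<N. \<Sum>v\<in>set_mset m. entry (k + v) b b x * mcoeff (J x) (m - {#v#}))"
        by (simp add: entry_add flip: sum_distrib_right)
      also have "\<dots> = (\<Sum>v\<in>set_mset m. tr (k + v) x * mcoeff (J x) (m - {#v#}))"
        by (subst sum.swap) (simp add: tr_eq sum_distrib_right)
      finally show ?thesis .
    qed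
    ultimately show "(\<Sum>p\<in>?I. f' p x) =
      (\<Sum>j<k. 1 / of_nat N * (tr j x * tr (k - 1 - j) x * mcoeff (J x) m)) +
      (\<Sum>v\<in>set_mset m. tr (k + v) x * mcoeff (J x) (m - {#v#}))"
      by (simp add: f'_def case_prod_unfold sum.distrib sum.cartesian_product)
  qed
  also have "gint \<dots> = (\<Sum>j<k. 1 / of_nat N * gint (\<lambda>x. tr j x * tr (k - 1 - j) x * mcoeff (J x) m)) +
     (\<Sum>v\<in>set_mset m. gint (\<lambda>x. tr (k + v) x * mcoeff (J x) (m - {#v#})))"
    by (simp only: gint_add gint_sum gint_cmult gintegrable_sum gintegrable_cmult int1 int2)
  finally show ?thesis .
qed

lemma loop_equation_partition_series:
  fixes k :: nat
  defines "Z \<equiv> partition_series N"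
  shows "mcoeff (var_op N (Suc k) Z) m =
     (\<Sum>j<k. mcoeff (var_op N j (var_op N (k - 1 - j) Z)) m) +
     (\<Sum>v\<in>set_mset m. mcoeff (var_op N (k + v) Z) (m - {#v#}))"
proof -
  have var_op_const: "var_op N n (mconst c * f) = mconst c * var_op N n f" for n c f
    by (simp add: var_op_def mult.left_commute)
  have 1: "mcoeff (var_op N n Z) m = 1 / of_nat N * gexp (\<lambda>x. tr n x * mcoeff (J x) m)" for n m
    unfolding Z_def partition_series_eq var_op_gexp_series var_op_J
    by (simp add: gexp_series_def flip: gexp_cmult)
  have 2: "mcoeff (var_op N n (var_op N l Z)) m =
      1 / of_nat N * (1 / of_nat N * gexp (\<lambda>x. tr n x * tr l x * mcoeff (J x) m))" for n l m
    unfolding Z_def partition_series_eq var_op_gexp_series var_op_J var_op_const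
    by (simp add: gexp_series_def mult.assoc mult.left_commute[where 'a = complex] flip: gexp_cmult)
  have "gexp (\<lambda>x. tr (Suc k) x * mcoeff (J x) m) =
     (\<Sum>j<k. 1 / of_nat N * gexp (\<lambda>x. tr j x * tr (k - 1 - j) x * mcoeff (J x) m)) +
     (\<Sum>v\<in>set_mset m. gexp (\<lambda>x. tr (k + v) x * mcoeff (J x) (m - {#v#})))"
    unfolding gexp_def schwinger_dyson by (simp add: add_divide_distrib sum_divide_distrib)
  thus ?thesis unfolding 1 2 by (simp add: distrib_left sum_distrib_left add_divide_distrib sum_divide_distrib)
qed

end

text \<open>The infinite sum of the series \<open>a(v + 1) W v\<close>.\<close>

definition vsum :: "('v \<Rightarrow> ('v, 'a :: comm_ring_1) mseries) \<Rightarrow> ('v, 'a) mseries" where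
  "vsum W = Abs_mseries (\<lambda>m. \<Sum>v\<in>set_mset m. mcoeff (W v) (m - {#v#}))"

lemma mcoeff_vsum:
  assumes "finite V" "set_mset m \<subseteq> V"
  shows "mcoeff (vsum W) m = mcoeff (\<Sum>v\<in>V. mvar v * W v) m"
proof -
  have "mcoeff (\<Sum>v\<in>V. mvar v * W v) m = (\<Sum>v\<in>V. if v \<in># m then mcoeff (W v) (m - {#v#}) else 0)"
    by (simp add: mcoeff_var_mult)
  also have "\<dots> = (\<Sum>v\<in>set_mset m. mcoeff (W v) (m - {#v#}))"
    using assms by (intro sum.mono_neutral_cong_right) auto
  finally show ?thesis by (simp add: vsum_def)
qed

lemma vsum_mult: "vsum (\<lambda>v. W v * f) = vsum W * f"
proof (rule mseries_eqI)
  fix m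
  have "mcoeff (vsum W * f) m = mcoeff ((\<Sum>v\<in>set_mset m. mvar v * W v) * f) m"
    by (rule mcoeff_mult_cong) (auto intro!: mcoeff_vsum dest: set_mset_mono simp del: mcoeff_sum)
  thus "mcoeff (vsum (\<lambda>v. W v * f)) m = mcoeff (vsum W * f) m"
    by (subst mcoeff_vsum[of "set_mset m"]) (auto simp: sum_distrib_right mult.assoc)
qed

text \<open>This is what truncation is for: the sum over all variables becomes finite.\<close>

lemma trunc_vsum: "finite V \<Longrightarrow> trunc V (vsum W) = (\<Sum>v\<in>V. mvar v * trunc V (W v))"
proof (rule mseries_eqI)
  fix m
  assume V: "finite V"
  have "set_mset (m - {#v#}) \<subseteq> V \<longleftrightarrow> set_mset m \<subseteq> V" if "v \<in> V" "v \<in># m" for v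
  proof -
    have "set_mset m = insert v (set_mset (m - {#v#}))"
      using that(2) by (metis insert_DiffM set_mset_add_mset_insert)
    thus ?thesis using that(1) by auto
  qed
  hence "mcoeff (\<Sum>v\<in>V. mvar v * trunc V (W v)) m =
      (if set_mset m \<subseteq> V then mcoeff (\<Sum>v\<in>V. mvar v * W v) m else 0)"
    by (auto simp: mcoeff_var_mult mcoeff_trunc intro!: sum.cong sum.neutral)
  thus "mcoeff (trunc V (vsum W)) m = mcoeff (\<Sum>v\<in>V. mvar v * trunc V (W v)) m"
    using V by (simp add: mcoeff_trunc mcoeff_vsum del: mcoeff_sum)
qed

subsection \<open>The correlators\<close>

text \<open>As a logarithmic derivative, this is the mean of \<open>Tr(M^n) / N\<close> in the
  interacting ensemble.\<close>

definition corr :: "nat \<Rightarrow> nat \<Rightarrow> complex aseries" where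
  "corr N n = (if n = 0 then 1 else var_op N n (mln (partition_series N)))"

text \<open>The derivation part of \<open>var_op\<close>, absent for \<open>j = 0\<close>, where
  \<open>var_op\<close> is the identity. It makes the product rule \<open>Z2\<close> below uniform
  in \<open>j\<close>.\<close>

definition ins_op :: "nat \<Rightarrow> nat \<Rightarrow> complex aseries \<Rightarrow> complex aseries" where
  "ins_op N j f = (if j = 0 then 0 else var_op N j f)"

text \<open>The linear equation for the partition series is divided by that series. A double
  insertion becomes a product of correlators plus a connected term, which carries the factor
  \<open>1 / N^2\<close> of \<open>var_op\<close>.\<close>

lemma (in gue) loop_equation:
  "corr N (Suc k) =
     (\<Sum>j<k. corr N j * corr N (k - 1 - j) + ins_op N j (corr N (k - 1 - j))) +
     vsum (\<lambda>v. corr N (k + v))"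
proof -
  define Z where "Z = partition_series N"
  have Z0: "mcoeff Z {#} = 1" by (simp add: Z_def partition_series_empty)
  have Z1: "var_op N n Z = corr N n * Z" for n
    unfolding var_op_def corr_def Z_def[symmetric] pd_mln[OF Z0, symmetric]
    by (simp add: mult.assoc mult.left_commute mult.commute[of _ Z])
  have Z2: "var_op N j (f * Z) = (corr N j * f + ins_op N j f) * Z" for j f
  proof (cases "j = 0")
    case False
    have "pd (j - 1) (f * Z) = pd (j - 1) f * Z + f * pd (j - 1) Z" by (rule pd_mult)
    moreover have "mconst (of_nat j / (of_nat N)\<^sup>2) * pd (j - 1) Z = corr N j * Z"
      using Z1[of j] False by (simp add: var_op_def)
    ultimately show ?thesis using False
      by (simp add: var_op_def ins_op_def distrib_left distrib_right mult_ac)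
  qed (simp add: var_op_def corr_def ins_op_def)
  have "Z * corr N (Suc k) = var_op N (Suc k) Z" by (simp add: Z1 mult.commute)
  also have "\<dots> = (\<Sum>j<k. var_op N j (var_op N (k - 1 - j) Z)) + vsum (\<lambda>v. var_op N (k + v) Z)"
    by (rule mseries_eqI) (simp add: Z_def loop_equation_partition_series vsum_def)
  also have "\<dots> = Z * ((\<Sum>j<k. corr N j * corr N (k - 1 - j) + ins_op N j (corr N (k - 1 - j))) +
     vsum (\<lambda>v. corr N (k + v)))"
    unfolding Z1 Z2 vsum_mult by (simp add: sum_distrib_right sum_distrib_left distrib_left mult.commute)
  finally show ?thesis by (rule mult_left_cancel_mseries[rotated]) (simp add: Z0)
qed

section \<open>Weights of monomials and polynomial dependence on the inverse square of the matrix
  size\<close>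

lemma adeg_simps [simp]:
  "adeg {#} = 0" "adeg (add_mset v m) = Suc v + adeg m" "adeg (a + b) = adeg a + adeg b"
  by (simp_all add: adeg_def)

lemma adeg_remove: "v \<in># m \<Longrightarrow> adeg m = Suc v + adeg (m - {#v#})"
  by (metis adeg_simps(2) insert_DiffM)

definition ev :: "rat poly \<Rightarrow> nat \<Rightarrow> complex" where
  "ev p N = of_rat (poly p (1 / (of_nat N)\<^sup>2))"

definition genus_poly :: "(nat \<Rightarrow> complex) \<Rightarrow> bool" where
  "genus_poly \<phi> \<longleftrightarrow> (\<exists>p. \<forall>N\<ge>1. \<phi> N = ev p N)"

lemma genus_polyI: "(\<And>N. N \<ge> 1 \<Longrightarrow> \<phi> N = ev p N) \<Longrightarrow> genus_poly \<phi>"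
  by (auto simp: genus_poly_def)

lemma genus_poly_cong: "(\<And>N. N \<ge> 1 \<Longrightarrow> \<phi> N = \<psi> N) \<Longrightarrow> genus_poly \<psi> \<Longrightarrow> genus_poly \<phi>"
  by (auto simp: genus_poly_def)

lemma genus_poly_rat: "genus_poly (\<lambda>_. of_rat c)"
  by (rule genus_polyI[of _ "[:c:]"]) (simp add: ev_def)

lemma genus_poly_inv: "genus_poly (\<lambda>N. 1 / (of_nat N)\<^sup>2)"
  by (rule genus_polyI[of _ "[:0, 1:]"]) (simp add: ev_def of_rat_divide of_rat_power)

lemma genus_poly_add: "genus_poly \<phi> \<Longrightarrow> genus_poly \<psi> \<Longrightarrow> genus_poly (\<lambda>N. \<phi> N + \<psi> N)"
  unfolding genus_poly_def by (metis ev_def of_rat_add poly_add)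

lemma genus_poly_mult: "genus_poly \<phi> \<Longrightarrow> genus_poly \<psi> \<Longrightarrow> genus_poly (\<lambda>N. \<phi> N * \<psi> N)"
  unfolding genus_poly_def by (metis ev_def of_rat_mult poly_mult)

lemma genus_poly_sum: "(\<And>i. i \<in> A \<Longrightarrow> genus_poly (\<phi> i)) \<Longrightarrow> genus_poly (\<lambda>N. \<Sum>i\<in>A. \<phi> i N)"
  using genus_poly_rat[of 0]
  by (induction A rule: infinite_finite_induct) (auto intro: genus_poly_add)

lemma genus_poly_of_nat: "genus_poly (\<lambda>_. of_nat n)"
  using genus_poly_rat[of "of_nat n"] by simp

text \<open>The difference would have the infinitely many roots \<open>1 / N^2\<close>. This makes
  the genus expansion unique.\<close>

lemma ev_inject:
  assumes "\<And>N. N \<ge> 1 \<Longrightarrow> ev p N = ev q N"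
  shows "p = q"
proof (rule ccontr)
  assume "p \<noteq> q"
  hence "finite {x. poly (p - q) x = 0}" by (intro poly_roots_finite) simp
  moreover have "(\<lambda>N. 1 / (of_nat N)\<^sup>2) ` {1..} \<subseteq> {x :: rat. poly (p - q) x = 0}"
    using assms by (auto simp: ev_def)
  ultimately have "finite ((\<lambda>N :: nat. 1 / (of_nat N)\<^sup>2 :: rat) ` {1..})"
    by (rule finite_subset[rotated])
  moreover have "inj_on (\<lambda>N :: nat. 1 / (of_nat N)\<^sup>2 :: rat) {1..}"
  proof (rule inj_onI)
    fix M N :: nat
    assume "1 / (of_nat M)\<^sup>2 = (1 / (of_nat N)\<^sup>2 :: rat)"
    hence "(of_nat (M\<^sup>2) :: rat) = of_nat (N\<^sup>2)" by simp
    thus "M = N" by (simp only: of_nat_eq_iff power2_eq_iff_nonneg)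
  qed
  ultimately have "finite {1 :: nat..}" by (rule finite_imageD)
  thus False by (simp add: infinite_Ici)
qed

lemma ev_tendsto: "(\<lambda>N. ev p N) \<longlonglongrightarrow> of_rat (coeff p 0)"
proof -
  have "(\<lambda>N. 1 / (of_nat N :: complex)\<^sup>2) \<longlonglongrightarrow> 0"
    using tendsto_power[OF lim_1_over_n[where 'a = complex], of 2] by (simp add: power_divide)
  hence "(\<lambda>N. poly (map_poly of_rat p) (1 / (of_nat N :: complex)\<^sup>2)) \<longlonglongrightarrow> poly (map_poly of_rat p) 0"
    by (rule tendsto_poly)
  moreover have "poly (map_poly of_rat p) (1 / (of_nat N :: complex)\<^sup>2) = ev p N" for N
    using of_rat_hom.poly_map_poly[of p "1 / (of_nat N)\<^sup>2"]
    by (simp add: ev_def of_rat_divide of_rat_power)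
  ultimately show ?thesis by (simp add: of_rat_hom.poly_map_poly_0 poly_0_coeff_0)
qed

text \<open>
  Each term of the loop equation has total weight \<open>n + adeg m\<close> two less than its left-hand side, so that the
  equation computes all coefficients recursively.
\<close>

lemma genus_poly_corr: "genus_poly (\<lambda>N. mcoeff (corr N n) m)"
proof (induction "n + adeg m" arbitrary: n m rule: less_induct)
  case less
  show ?case
  proof (cases n)
    case 0
    thus ?thesis using genus_poly_rat[of 0] genus_poly_rat[of 1]
      by (cases "m = {#}") (simp_all add: corr_def mcoeff_one)
  next
    case (Suc k)
    have prod: "genus_poly (\<lambda>N. mcoeff (corr N j * corr N (k - 1 - j)) m)" if "j < k" for j
    proof -
      have "genus_poly (\<lambda>N. mcoeff (corr N j) a * mcoeff (corr N (k - 1 - j)) b)" if "a + b = m" for a b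
        using \<open>j < k\<close> that Suc by (intro genus_poly_mult less) auto
      thus ?thesis unfolding mcoeff_mult case_prod_unfold by (intro genus_poly_sum) auto
    qed
    have ins: "genus_poly (\<lambda>N. mcoeff (ins_op N j (corr N (k - 1 - j))) m)" if "j < k" for j
    proof (cases j)
      case 0
      thus ?thesis using genus_poly_rat[of 0] by (simp add: ins_op_def)
    next
      case (Suc i)
      have "genus_poly (\<lambda>N. of_nat (j * Suc (count m i)) * (1 / (of_nat N)\<^sup>2) *
          mcoeff (corr N (k - 1 - j)) (add_mset i m))"
        using \<open>j < k\<close> Suc \<open>n = Suc k\<close>
        by (intro genus_poly_mult genus_poly_of_nat genus_poly_inv less) auto
      thus ?thesis
        by (rule genus_poly_cong[rotated]) (simp add: ins_op_def var_op_def Suc mcoeff_pd del: of_nat_Suc mult_Suc mult_Suc_right)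
    qed
    have vs: "genus_poly (\<lambda>N. mcoeff (corr N (k + v)) (m - {#v#}))" if "v \<in># m" for v
      using adeg_remove[OF that] Suc by (intro less) auto
    have "genus_poly (\<lambda>N. (\<Sum>j<k. mcoeff (corr N j * corr N (k - 1 - j)) m +
        mcoeff (ins_op N j (corr N (k - 1 - j))) m) + (\<Sum>v\<in>set_mset m. mcoeff (corr N (k + v)) (m - {#v#})))"
      by (intro genus_poly_add genus_poly_sum prod ins vs) auto
    thus ?thesis
    proof (rule genus_poly_cong[rotated])
      fix N :: nat assume "N \<ge> 1"
      then interpret gue N by unfold_locales
      show "mcoeff (corr N n) m = (\<Sum>j<k. mcoeff (corr N j * corr N (k - 1 - j)) m +
        mcoeff (ins_op N j (corr N (k - 1 - j))) m) + (\<Sum>v\<in>set_mset m. mcoeff (corr N (k + v)) (m - {#v#}))"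
        unfolding Suc loop_equation by (simp add: vsum_def)
    qed
  qed
qed

lemma mcoeff_ln_partition_series_empty: "N \<ge> 1 \<Longrightarrow> mcoeff (mln (partition_series N)) {#} = 0"
  by (simp add: gue_def gue.partition_series_empty mcoeff_mln_empty)

text \<open>For nonempty \<open>m\<close>, pick a variable in \<open>m\<close>: its correlator at
  the remaining monomial is \<open>d / N^2\<close> times the coefficient of the logarithm.\<close>

lemma genus_poly_free_energy:
  "\<exists>p. \<forall>N\<ge>1. mcoeff (mln (partition_series N)) m = (of_nat N)\<^sup>2 * ev p N"
proof (cases "m = {#}")
  case True
  have "\<forall>N\<ge>1. mcoeff (mln (partition_series N)) m = (of_nat N)\<^sup>2 * ev 0 N"
    by (simp add: True mcoeff_ln_partition_series_empty ev_def)
  thus ?thesis by blast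
next
  case False
  then obtain v where v: "v \<in># m" by blast
  define d :: nat where "d = Suc v * count m v"
  have d: "d \<noteq> 0" using v by (simp add: d_def)
  have "genus_poly (\<lambda>N. of_rat (1 / of_nat d) * mcoeff (corr N (Suc v)) (m - {#v#}))"
    by (intro genus_poly_mult genus_poly_rat genus_poly_corr)
  then obtain p where p: "N \<ge> 1 \<Longrightarrow> of_rat (1 / of_nat d) * mcoeff (corr N (Suc v)) (m - {#v#}) = ev p N" for N
    by (auto simp: genus_poly_def)
  have "mcoeff (mln (partition_series N)) m = (of_nat N)\<^sup>2 * ev p N" if "N \<ge> 1" for N
  proof -
    have "mcoeff (corr N (Suc v)) (m - {#v#}) = of_nat d / (of_nat N)\<^sup>2 * mcoeff (mln (partition_series N)) m"
      using v by (simp add: corr_def var_op_def mcoeff_pd d_def del: of_nat_Suc mult_Suc mult_Suc_right)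
    thus ?thesis using p[OF that] that d by (auto simp: field_simps of_rat_divide)
  qed
  thus ?thesis by blast
qed

section \<open>Existence and uniqueness of the genus expansion\<close>

lemma genus_sum_eq:
  assumes "finite {g. c g \<noteq> 0}" "\<And>g. coeff p g = c g" "N \<ge> 1"
  shows "(\<Sum>g | c g \<noteq> 0. of_nat N powi (2 - 2 * int g) * of_rat (c g)) = (of_nat N :: complex)\<^sup>2 * ev p N"
proof -
  have "(\<Sum>g | c g \<noteq> 0. of_nat N powi (2 - 2 * int g) * of_rat (c g)) =
      (\<Sum>g\<le>degree p. of_nat N powi (2 - 2 * int g) * of_rat (c g) :: complex)"
    by (rule sum.mono_neutral_left) (auto simp flip: assms(2) intro: le_degree)
  also have "\<dots> = (\<Sum>g\<le>degree p. (of_nat N)\<^sup>2 * of_rat (coeff p g * (1 / (of_nat N)\<^sup>2) ^ g))"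
  proof (rule sum.cong[OF refl])
    fix g
    have "(of_nat N :: complex) powi (2 - 2 * int g) = (of_nat N)\<^sup>2 * (1 / (of_nat N)\<^sup>2) ^ g"
      using assms(3) by (simp add: power_int_diff power_int_mult power_divide)
    thus "of_nat N powi (2 - 2 * int g) * of_rat (c g) =
        ((of_nat N)\<^sup>2 :: complex) * of_rat (coeff p g * (1 / (of_nat N)\<^sup>2) ^ g)"
      by (simp add: assms(2) of_rat_mult of_rat_power of_rat_divide)
  qed
  also have "\<dots> = (of_nat N)\<^sup>2 * ev p N"
    by (simp add: ev_def poly_altdef sum_distrib_left of_rat_sum)
  finally show ?thesis .
qed

lemma genus_expansion_iff:
  "genus_expansion F \<longleftrightarrow> (\<forall>m. \<exists>p. (\<forall>g. coeff p g = mcoeff (F g) m) \<and>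
     (\<forall>N\<ge>1. mcoeff (mln (partition_series N)) m = (of_nat N)\<^sup>2 * ev p N))" (is "_ \<longleftrightarrow> (\<forall>m. \<exists>p. ?P m p)")
proof
  assume F: "genus_expansion F"
  show "\<forall>m. \<exists>p. ?P m p"
  proof
    fix m
    have fin: "finite {g. mcoeff (F g) m \<noteq> 0}" using F by (simp add: genus_expansion_def)
    define p where "p = Abs_poly (\<lambda>g. mcoeff (F g) m)"
    have p: "coeff p = (\<lambda>g. mcoeff (F g) m)"
      unfolding p_def by (rule Abs_poly_inverse) (use fin in \<open>simp add: MOST_iff_cofinite\<close>)
    have "?P m p"
      using F genus_sum_eq[OF fin, of p] by (auto simp: genus_expansion_def p)
    thus "\<exists>p. ?P m p" ..
  qed
next
  assume r: "\<forall>m. \<exists>p. ?P m p"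
  show "genus_expansion F"
    unfolding genus_expansion_def
  proof
    fix m
    from r obtain p where p: "?P m p" by blast
    have fin: "finite {g. mcoeff (F g) m \<noteq> 0}"
      by (rule finite_subset[of _ "{..degree p}"]) (use p in \<open>auto intro: le_degree\<close>)
    thus "finite {g. mcoeff (F g) m \<noteq> 0} \<and> (\<forall>N\<ge>1. mcoeff (mln (partition_series N)) m =
        (\<Sum>g | mcoeff (F g) m \<noteq> 0. of_nat N powi (2 - 2 * int g) * of_rat (mcoeff (F g) m)))"
      using p genus_sum_eq[OF fin, of p] by auto
  qed
qed

text \<open>\<open>free_energy\<close> is given by a definite description, so existence, from the
  polynomials, and uniqueness, from \<open>ev_inject\<close>, are both needed.\<close>

lemma genus_expansion_free_energy: "genus_expansion free_energy"
proof -
  from genus_poly_free_energy obtain p where p: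
    "\<And>m N. N \<ge> 1 \<Longrightarrow> mcoeff (mln (partition_series N)) m = (of_nat N)\<^sup>2 * ev (p m) N"
    by metis
  have "\<exists>!F. genus_expansion F"
  proof
    show "genus_expansion (\<lambda>g. Abs_mseries (\<lambda>m. coeff (p m) g))"
      unfolding genus_expansion_iff using p by auto
  next
    fix F assume F: "genus_expansion F"
    show "F = (\<lambda>g. Abs_mseries (\<lambda>m. coeff (p m) g))"
    proof (intro ext mseries_eqI)
      fix g m
      from F obtain q where q: "\<And>g. coeff q g = mcoeff (F g) m"
        "\<And>N. N \<ge> 1 \<Longrightarrow> mcoeff (mln (partition_series N)) m = (of_nat N)\<^sup>2 * ev q N"
        unfolding genus_expansion_iff by blast
      have "q = p m"
      proof (rule ev_inject)
        fix N :: nat assume "N \<ge> 1"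
        thus "ev q N = ev (p m) N" using p[of N m] q(2)[of N] by simp
      qed
      thus "mcoeff (F g) m = mcoeff (Abs_mseries (\<lambda>m. coeff (p m) g)) m"
        by (simp add: q(1)[symmetric])
    qed
  qed
  thus ?thesis unfolding free_energy_def by (rule theI')
qed

subsection \<open>The planar limit\<close>

text \<open>The limit of \<open>corr\<close>: the factor \<open>1 / N^2\<close> in
  \<open>var_op\<close> cancels the leading power of \<open>N\<close> in the free energy.\<close>

definition planar :: "nat \<Rightarrow> rat aseries" where
  "planar n = (if n = 0 then 1 else of_nat n * pd (n - 1) (free_energy 0))"

lemma free_energy_tendsto:
  "(\<lambda>N. mcoeff (mln (partition_series N)) m / (of_nat N)\<^sup>2) \<longlonglongrightarrow> of_rat (mcoeff (free_energy 0) m)"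
proof -
  obtain p where p: "\<And>g. coeff p g = mcoeff (free_energy g) m"
    "\<And>N. N \<ge> 1 \<Longrightarrow> mcoeff (mln (partition_series N)) m = (of_nat N)\<^sup>2 * ev p N"
    using genus_expansion_free_energy unfolding genus_expansion_iff by blast
  have "\<forall>\<^sub>F N in sequentially. ev p N = mcoeff (mln (partition_series N)) m / (of_nat N)\<^sup>2"
    using eventually_ge_at_top[of 1] by eventually_elim (simp add: p(2))
  moreover have "(\<lambda>N. ev p N) \<longlonglongrightarrow> of_rat (mcoeff (free_energy 0) m)"
    using ev_tendsto[of p] by (simp add: p(1))
  ultimately show ?thesis by (rule Lim_transform_eventually[rotated])
qed

lemma mcoeff_free_energy_empty: "mcoeff (free_energy 0) {#} = 0"
proof -
  have "\<forall>\<^sub>F N in sequentially. mcoeff (mln (partition_series N)) {#} / (of_nat N)\<^sup>2 = 0"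
    using eventually_ge_at_top[of 1] by eventually_elim (simp add: mcoeff_ln_partition_series_empty)
  hence "(\<lambda>N. mcoeff (mln (partition_series N)) {#} / (of_nat N)\<^sup>2) \<longlonglongrightarrow> 0"
    by (rule tendsto_eventually)
  from LIMSEQ_unique[OF free_energy_tendsto this] show ?thesis by simp
qed

lemma corr_tendsto: "(\<lambda>N. mcoeff (corr N n) m) \<longlonglongrightarrow> of_rat (mcoeff (planar n) m)"
proof (cases n)
  case 0
  thus ?thesis by (simp add: corr_def planar_def mcoeff_one)
next
  case (Suc v)
  have "(\<lambda>N. of_nat (n * Suc (count m v)) * (mcoeff (mln (partition_series N)) (add_mset v m) / (of_nat N)\<^sup>2))
      \<longlonglongrightarrow> of_nat (n * Suc (count m v)) * of_rat (mcoeff (free_energy 0) (add_mset v m))"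
    by (intro tendsto_mult tendsto_const free_energy_tendsto)
  thus ?thesis
    by (simp add: corr_def planar_def var_op_def Suc mcoeff_pd of_rat_mult mult.assoc del: of_nat_Suc mult_Suc mult_Suc_right)
qed

text \<open>In the limit of \<open>loop_equation\<close> the connected term disappears because of
  its factor \<open>1 / N^2\<close>.\<close>

lemma planar_loop_equation:
  "planar (Suc k) = (\<Sum>j<k. planar j * planar (k - 1 - j)) + vsum (\<lambda>v. planar (k + v))"
proof (rule mseries_eqI)
  fix m
  have prod: "(\<lambda>N. mcoeff (corr N j * corr N l) m) \<longlonglongrightarrow> of_rat (mcoeff (planar j * planar l) m)" for j l
    unfolding mcoeff_mult of_rat_sum case_prod_unfold of_rat_mult
    by (intro tendsto_sum tendsto_mult corr_tendsto)
  have ins: "(\<lambda>N. mcoeff (ins_op N j (corr N l)) m) \<longlonglongrightarrow> 0" for j l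
  proof (cases j)
    case (Suc i)
    have "(\<lambda>N. 1 / (of_nat N :: complex)\<^sup>2) \<longlonglongrightarrow> 0"
      using tendsto_power[OF lim_1_over_n[where 'a = complex], of 2] by (simp add: power_divide)
    hence "(\<lambda>N. 1 / (of_nat N)\<^sup>2 * (of_nat (j * Suc (count m i)) * mcoeff (corr N l) (add_mset i m)))
        \<longlonglongrightarrow> 0 * (of_nat (j * Suc (count m i)) * of_rat (mcoeff (planar l) (add_mset i m)))"
      by (intro tendsto_mult tendsto_const corr_tendsto)
    thus ?thesis by (simp add: ins_op_def var_op_def Suc mcoeff_pd mult.assoc del: of_nat_Suc mult_Suc mult_Suc_right)
  qed (simp add: ins_op_def)
  have "(\<lambda>N. (\<Sum>j<k. mcoeff (corr N j * corr N (k - 1 - j)) m + mcoeff (ins_op N j (corr N (k - 1 - j))) m) +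
      (\<Sum>v\<in>set_mset m. mcoeff (corr N (k + v)) (m - {#v#})))
    \<longlonglongrightarrow> (\<Sum>j<k. of_rat (mcoeff (planar j * planar (k - 1 - j)) m) + 0) +
      (\<Sum>v\<in>set_mset m. of_rat (mcoeff (planar (k + v)) (m - {#v#})))"
    by (intro tendsto_add tendsto_sum prod ins corr_tendsto)
  moreover have "\<forall>\<^sub>F N in sequentially.
     (\<Sum>j<k. mcoeff (corr N j * corr N (k - 1 - j)) m + mcoeff (ins_op N j (corr N (k - 1 - j))) m) +
      (\<Sum>v\<in>set_mset m. mcoeff (corr N (k + v)) (m - {#v#})) = mcoeff (corr N (Suc k)) m"
    using eventually_ge_at_top[of 1]
  proof eventually_elim
    case (elim N)
    then interpret gue N by unfold_locales
    show ?case unfolding loop_equation by (simp add: vsum_def)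
  qed
  ultimately have "(\<lambda>N. mcoeff (corr N (Suc k)) m) \<longlonglongrightarrow> (\<Sum>j<k. of_rat (mcoeff (planar j * planar (k - 1 - j)) m) + 0) +
      (\<Sum>v\<in>set_mset m. of_rat (mcoeff (planar (k + v)) (m - {#v#})))"
    by (rule Lim_transform_eventually)
  from LIMSEQ_unique[OF corr_tendsto this]
  have "(of_rat (mcoeff (planar (Suc k)) m) :: complex) =
      of_rat (mcoeff ((\<Sum>j<k. planar j * planar (k - 1 - j)) + vsum (\<lambda>v. planar (k + v))) m)"
    by (simp add: of_rat_add of_rat_sum vsum_def)
  thus "mcoeff (planar (Suc k)) m =
      mcoeff ((\<Sum>j<k. planar j * planar (k - 1 - j)) + vsum (\<lambda>v. planar (k + v))) m"
    by (simp only: of_rat_eq_iff)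
qed

lemma adeg_eq_sum: "adeg m = (\<Sum>v\<in>set_mset m. Suc v * count m v)"
proof -
  have "adeg m = (\<Sum>v\<in>A. Suc v * count m v)" if "finite A" "set_mset m \<subseteq> A" for A
    using that(2)
  proof (induction m)
    case (add x m)
    have "(\<Sum>v\<in>A. Suc v * count (add_mset x m) v) = (\<Sum>v\<in>A. Suc v * count m v + (if v = x then Suc v else 0))"
      by (rule sum.cong) auto
    thus ?case using add that(1) by (simp add: sum.distrib del: mult_Suc)
  qed simp
  thus ?thesis by simp
qed

text \<open>In the loop equation for \<open>k = 1\<close> the sum over the variables is the Euler
  field, the sum of \<open>n a(n) d/da(n)\<close>, applied to the free energy; it multiplies the
  coefficient at \<open>m\<close> by \<open>adeg m\<close>. The convolution contributes 1.\<close>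

lemma mcoeff_planar_2: "mcoeff (planar 2) m = of_nat (adeg m) * mcoeff (free_energy 0) m + (if m = {#} then 1 else 0)"
proof -
  have "mcoeff (planar (Suc v)) (m - {#v#}) = of_nat (Suc v * count m v) * mcoeff (free_energy 0) m"
    if "v \<in># m" for v
    using that by (simp add: planar_def mcoeff_pd mult.assoc del: of_nat_Suc mult_Suc mult_Suc_right)
  hence "mcoeff (vsum (\<lambda>v. planar (Suc v))) m = of_nat (adeg m) * mcoeff (free_energy 0) m"
    by (simp add: vsum_def adeg_eq_sum sum_distrib_right of_nat_sum del: of_nat_mult of_nat_Suc mult_Suc)
  moreover have "planar 2 = 1 + vsum (\<lambda>v. planar (Suc v))"
    using planar_loop_equation[of 1] by (simp add: planar_def numeral_2_eq_2)
  ultimately show ?thesis by (simp add: mcoeff_one)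
qed

text \<open>
  The Euler field rescales the potential, so up to a dilation it varies the quadratic term alone;
  applied to the planar second moment it gives the planar covariance of \<open>Tr(M\<^sup>2)\<close> with itself.
\<close>

lemma planar_euler:
  "of_nat (adeg m * (adeg m + 2)) * mcoeff (free_energy 0) m =
     mcoeff (2 * pd 1 (planar 2)) m - (if m = {#} then 2 else 0)"
proof -
  \<comment> \<open>The index 1 belongs to a(2), of weight 2. The remaining factor is again a
    coefficient of \<open>planar 2\<close>, to which \<open>mcoeff_planar_2\<close> applies a second
    time.\<close>
  have "mcoeff (2 * pd 1 (planar 2)) m =
      of_nat (adeg m + 2) * (2 * of_nat (Suc (count m 1)) * mcoeff (free_energy 0) (add_mset 1 m))"
    by (simp add: mcoeff_pd mcoeff_planar_2 del: of_nat_Suc mult_Suc mult_Suc_right)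
  also have "2 * of_nat (Suc (count m 1)) * mcoeff (free_energy 0) (add_mset 1 m) = mcoeff (planar 2) m"
    by (simp add: planar_def mcoeff_pd del: of_nat_Suc mult_Suc mult_Suc_right)
  finally show ?thesis by (simp add: mcoeff_planar_2 algebra_simps)
qed

subsection \<open>The spectral curve\<close>

abbreviation zcoeff :: "'a :: zero fls \<Rightarrow> int \<Rightarrow> 'a" (infixl "$z" 75) where
  "f $z n \<equiv> fls_nth f n"

lemma fls_shift_mult_nth [simp]:
  fixes f :: "'a :: comm_ring_1 fls"
  shows "(fls_X * f) $z k = f $z (k - 1)" "(f * fls_X) $z k = f $z (k - 1)"
    "(fls_X ^ n * f) $z k = f $z (k - int n)" "(f * fls_X ^ n) $z k = f $z (k - int n)"
    "(fls_X_inv * f) $z k = f $z (k + 1)" "(f * fls_X_inv) $z k = f $z (k + 1)"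
    "(fls_X_inv ^ n * f) $z k = f $z (k + int n)" "(f * fls_X_inv ^ n) $z k = f $z (k + int n)"
  by (simp_all add: fls_X_times_conv_shift fls_X_inv_times_conv_shift
        fls_X_power_times_conv_shift fls_X_inv_power_times_conv_shift)

lemma fls_sum_nth: "(\<Sum>i\<in>A. f i) $z k = (\<Sum>i\<in>A. f i $z k)"
  by (induction A rule: infinite_finite_induct) auto

lemma fls_mult_nth_eq_0:
  fixes f g :: "'a :: comm_ring_1 fls"
  assumes "\<And>k. k > a \<Longrightarrow> f $z k = 0" "\<And>k. k > b \<Longrightarrow> g $z k = 0" "k > a + b"
  shows "(f * g) $z k = 0"
proof -
  have "f $z i * g $z (k - i) = 0" for i
    using assms(1)[of i] assms(2)[of "k - i"] assms(3) by (cases "i > a") auto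
  thus ?thesis by (simp add: fls_times_nth(2))
qed

locale spectral_curve =
  fixes R S :: "'a :: comm_ring_1" and a :: "nat \<Rightarrow> 'a" and K :: nat
  assumes two_cancel: "b + b = 0 \<Longrightarrow> b = (0 :: 'a)"
begin

definition X :: "'a fls" where
  "X = fls_X + fls_const S + fls_const R * fls_X_inv"

text \<open>The derivative of the potential at \<open>X\<close>, with \<open>a v\<close> in the role
  of a(v + 1) and only the first \<open>K\<close> variables kept.\<close>

definition V' :: "'a fls" where
  "V' = X - (\<Sum>v<K. fls_const (a v) * X ^ v)"

text \<open>This is \<open>z dX/dz\<close>; the constant coefficient of \<open>T * f\<close> is the
  residue of \<open>f dX\<close>.\<close>

definition T :: "'a fls" where
  "T = fls_X - fls_const R * fls_X_inv"

lemma X_mult_nth: "(X * f) $z k = f $z (k - 1) + S * f $z k + R * f $z (k + 1)"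
  by (simp add: X_def distrib_right mult.assoc)

lemma T_mult_nth: "(T * f) $z k = f $z (k - 1) - R * f $z (k + 1)"
  by (simp add: T_def left_diff_distrib mult.assoc)

text \<open>Invariance, resp. sign change, under exchanging \<open>z\<close> and \<open>R / z\<close>, without dividing by \<open>R\<close>.\<close>

definition sym :: "'a fls \<Rightarrow> bool" where
  "sym f \<longleftrightarrow> (\<forall>i j. R ^ j * f $z (int j - int i) = R ^ i * f $z (int i - int j))"

definition antisym :: "'a fls \<Rightarrow> bool" where
  "antisym f \<longleftrightarrow> (\<forall>i j. R ^ j * f $z (int j - int i) = - (R ^ i * f $z (int i - int j)))"

lemma sym_1: "sym 1"
  by (simp add: sym_def)

text \<open>The exchange fixes \<open>X\<close>, swapping its outer terms. Raising \<open>i\<close>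
  or \<open>j\<close> by one supplies the missing factor \<open>R\<close>.\<close>

lemma sym_X_mult:
  assumes "sym f"
  shows "sym (X * f)"
  unfolding sym_def
proof (intro allI)
  fix i j
  have s: "R ^ j * f $z (int j - int i) = R ^ i * f $z (int i - int j)" for i j
    using assms by (simp add: sym_def)
  have "R ^ j * f $z (int j - int i - 1) = R ^ i * (R * f $z (int i - int j + 1))"
    using s[of j "Suc i"] by (simp add: algebra_simps)
  moreover have "R ^ j * (R * f $z (int j - int i + 1)) = R ^ i * f $z (int i - int j - 1)"
    using s[of "Suc j" i] by (simp add: algebra_simps)
  moreover have "R ^ j * (S * f $z (int j - int i)) = R ^ i * (S * f $z (int i - int j))"
    using s[of j i] by (metis mult.left_commute)
  ultimately show "R ^ j * (X * f) $z (int j - int i) = R ^ i * (X * f) $z (int i - int j)"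
    by (simp add: X_mult_nth distrib_left)
qed

lemma sym_X_power: "sym (X ^ n)"
  by (induction n) (auto intro: sym_1 sym_X_mult)

lemma antisym_T_mult:
  assumes "sym f"
  shows "antisym (T * f)"
  unfolding antisym_def
proof (intro allI)
  fix i j
  have s: "R ^ j * f $z (int j - int i) = R ^ i * f $z (int i - int j)" for i j
    using assms by (simp add: sym_def)
  have "R ^ j * f $z (int j - int i - 1) = R ^ i * (R * f $z (int i - int j + 1))"
    using s[of j "Suc i"] by (simp add: algebra_simps)
  moreover have "R ^ j * (R * f $z (int j - int i + 1)) = R ^ i * f $z (int i - int j - 1)"
    using s[of "Suc j" i] by (simp add: algebra_simps)
  ultimately show "R ^ j * (T * f) $z (int j - int i) = - (R ^ i * (T * f) $z (int i - int j))"
    by (simp add: T_mult_nth right_diff_distrib)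
qed

lemma antisym_nth_0: "antisym f \<Longrightarrow> f $z 0 = 0"
  using two_cancel[of "f $z 0"] by (auto simp: antisym_def dest!: spec[of _ 0])

lemma sym_V': "sym V'"
proof -
  have "sym (fls_const c * f)" if "sym f" for c f
    using that by (auto simp: sym_def) (metis mult.left_commute)
  moreover have "sym (f - g)" if "sym f" "sym g" for f g
    using that by (auto simp: sym_def right_diff_distrib)
  moreover have "sym (\<Sum>i\<in>A. f i)" if "\<And>i. i \<in> A \<Longrightarrow> sym (f i)" for A :: "nat set" and f
    using that by (auto simp: sym_def fls_sum_nth sum_distrib_left intro!: sum.cong)
  ultimately show ?thesis
    using sym_X_power sym_X_power[of 1] by (simp add: V'_def)
qed

lemma X_power_nth_eq_0: "k > int n \<Longrightarrow> X ^ n $z k = 0"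
  by (induction n arbitrary: k) (auto simp: X_mult_nth)

lemma V'_nth_eq_0: "k > int (Suc K) \<Longrightarrow> V' $z k = 0"
  using X_power_nth_eq_0[of 1 k] by (auto simp: V'_def fls_sum_nth X_power_nth_eq_0 intro!: sum.neutral)

definition vn :: "nat \<Rightarrow> 'a" where
  "vn i = V' $z int i"

text \<open>The negative part of \<open>V'\<close>, written by symmetry with the positive
  coefficients, so that it is visibly the image of \<open>Vpos\<close> under the exchange. The bound
  \<open>Suc K\<close> also covers the linear term.\<close>

definition Vneg :: "'a fls" where
  "Vneg = (\<Sum>i\<in>{1..Suc K}. fls_const (R ^ i * vn i) * fls_X_inv ^ i)"

definition Vpos :: "'a fls" where
  "Vpos = (\<Sum>i\<in>{1..Suc K}. fls_const (vn i) * fls_X ^ i)"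

lemma Vneg_nth_nonneg: "k \<ge> 0 \<Longrightarrow> Vneg $z k = 0"
  unfolding Vneg_def fls_sum_nth by (rule sum.neutral) auto

lemma Vneg_nth: "i > 0 \<Longrightarrow> Vneg $z (- int i) = V' $z (- int i)"
proof -
  assume i: "i > 0"
  have "Vneg $z (- int i) = (\<Sum>j\<in>{1..Suc K}. if j = i then R ^ i * vn i else 0)"
    unfolding Vneg_def fls_sum_nth by (rule sum.cong) auto
  also have "\<dots> = R ^ i * vn i"
    using i V'_nth_eq_0[of "int i"] by (auto simp: vn_def)
  also have "\<dots> = V' $z (- int i)"
    using sym_V'[unfolded sym_def, rule_format, of 0 i] by (simp add: vn_def)
  finally show ?thesis .
qed

lemma Vpos_nth_nonpos: "k \<le> 0 \<Longrightarrow> Vpos $z k = 0"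
  unfolding Vpos_def fls_sum_nth by (rule sum.neutral) auto

lemma Vpos_nth: "i > 0 \<Longrightarrow> Vpos $z int i = V' $z int i"
proof -
  assume i: "i > 0"
  have "Vpos $z int i = (\<Sum>j\<in>{1..Suc K}. if j = i then vn i else 0)"
    unfolding Vpos_def fls_sum_nth by (rule sum.cong) auto
  also have "\<dots> = V' $z int i"
    using i V'_nth_eq_0[of "int i"] by (auto simp: vn_def)
  finally show ?thesis .
qed

text \<open>Of the \<open>n\<close> factors, \<open>2 * j - d\<close> are not \<open>S\<close>, and
  \<open>j\<close> of these are \<open>R / z\<close>. For \<open>d = 1\<close> and
  \<open>d = 0\<close> these are the inner sums of the system for \<open>R\<close> and
  \<open>S\<close>.\<close>

lemma X_power_nth:
  "X ^ n $z (- int d) = (\<Sum>j\<in>{d..(n + d) div 2}.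
     of_nat ((n choose (2 * j - d)) * ((2 * j - d) choose j)) * R ^ j * S ^ (n + d - 2 * j))"
proof -
  define Y where "Y = fls_const R * fls_X_inv + fls_X"
  have Y: "Y ^ m $z (- int d) = (\<Sum>j\<le>m. if m + d = 2 * j then of_nat (m choose j) * R ^ j else 0)" for m
  proof -
    have "Y ^ m = (\<Sum>j\<le>m. of_nat (m choose j) * (fls_const (R ^ j) * (fls_X_inv ^ j * fls_X ^ (m - j))))"
      by (simp add: Y_def binomial_ring power_mult_distrib fls_const_power mult.assoc)
    thus ?thesis
      by (auto simp: fls_sum_nth fls_mult_of_nat_nth intro!: sum.cong)
  qed
  have "X ^ n = (\<Sum>m\<le>n. of_nat (n choose m) * (fls_const (S ^ (n - m)) * Y ^ m))"
    using binomial_ring[of Y "fls_const S" n]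
    by (simp add: X_def Y_def fls_const_power mult_ac add_ac)
  hence "X ^ n $z (- int d) = (\<Sum>m\<le>n. of_nat (n choose m) * (S ^ (n - m) *
      (\<Sum>j\<le>m. if m + d = 2 * j then of_nat (m choose j) * R ^ j else 0)))"
    by (simp add: fls_sum_nth fls_mult_of_nat_nth Y)
  also have "\<dots> = (\<Sum>m\<le>n. \<Sum>j\<le>m. if m + d = 2 * j then
      of_nat ((n choose m) * (m choose j)) * R ^ j * S ^ (n - m) else 0)"
    unfolding sum_distrib_left by (intro sum.cong refl) (simp add: mult_ac)
  also have "\<dots> = (\<Sum>p\<in>(SIGMA m:{..n}. {..m}). if fst p + d = 2 * snd p then
      of_nat ((n choose fst p) * (fst p choose snd p)) * R ^ snd p * S ^ (n - fst p) else 0)"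
    by (subst sum.Sigma) (auto simp: case_prod_unfold)
  also have "\<dots> = (\<Sum>p\<in>{p \<in> (SIGMA m:{..n}. {..m}). fst p + d = 2 * snd p}.
      of_nat ((n choose (2 * snd p - d)) * ((2 * snd p - d) choose snd p)) * R ^ snd p * S ^ (n + d - 2 * snd p))"
  proof (rule sum.mono_neutral_cong_right)
    fix p assume p: "p \<in> {p \<in> (SIGMA m:{..n}. {..m}). fst p + d = 2 * snd p}"
    hence "fst p = 2 * snd p - d" "n - fst p = n + d - 2 * snd p" by auto
    thus "(if fst p + d = 2 * snd p then
        of_nat ((n choose fst p) * (fst p choose snd p)) * R ^ snd p * S ^ (n - fst p) else 0) =
      of_nat ((n choose (2 * snd p - d)) * ((2 * snd p - d) choose snd p)) * R ^ snd p * S ^ (n + d - 2 * snd p)"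
      using p by simp
  qed auto
  also have "\<dots> = (\<Sum>j\<in>{d..(n + d) div 2}.
     of_nat ((n choose (2 * j - d)) * ((2 * j - d) choose j)) * R ^ j * S ^ (n + d - 2 * j))"
    by (rule sum.reindex_bij_witness[of _ "\<lambda>j. (2 * j - d, j)" snd]) auto
  finally show ?thesis .
qed

end

section \<open>The resolvent, the covariances and their loop equations\<close>

locale normalized_spectral_curve = spectral_curve +
  assumes V'_0: "V' $z 0 = 0" and V'_1: "V' $z (- 1) = 1"
begin

lemma V'_split: "V' = Vpos + Vneg"
proof (rule fls_eqI)
  fix k :: int
  consider (pos) i where "i > 0" "k = int i" | (zero) "k = 0" | (neg) i where "i > 0" "k = - int i"
    by (metis int_cases4 of_nat_0 of_nat_0_less_iff neq0_conv)
  thus "V' $z k = (Vpos + Vneg) $z k"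
    by cases (simp_all add: Vpos_nth Vneg_nth V'_0 Vneg_nth_nonneg Vpos_nth_nonpos)
qed

text \<open>\<open>Vneg\<close> is the resolvent: the planar moments are the coefficients of its expansion in \<open>1 / X\<close>.\<close>

definition w :: "nat \<Rightarrow> 'a" where
  "w n = (X ^ n * (T * Vneg)) $z 0"

lemma w_0: "w 0 = 1"
  using Vneg_nth[of 1] by (simp add: w_def T_mult_nth V'_1 Vneg_nth_nonneg)

text \<open>Formally \<open>Vneg\<close> is the sum of all \<open>w i / X ^ (i + 1)\<close>; then
  \<open>P k\<close> is the part of \<open>X ^ k * Vneg\<close> that is polynomial in
  \<open>X\<close>, and \<open>rest k\<close> below is the tail.\<close>

definition P :: "nat \<Rightarrow> 'a fls" where
  "P k = (\<Sum>i<k. fls_const (w i) * X ^ (k - 1 - i))"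

definition rest :: "nat \<Rightarrow> 'a fls" where
  "rest k = X ^ k * Vneg - P k"

lemma P_Suc: "P (Suc k) = X * P k + fls_const (w k)"
proof -
  have "(\<Sum>i<k. fls_const (w i) * X ^ (k - i)) = X * P k"
    unfolding P_def sum_distrib_left
  proof (rule sum.cong[OF refl])
    fix i assume "i \<in> {..<k}"
    hence "k - i = Suc (k - 1 - i)" by auto
    thus "fls_const (w i) * X ^ (k - i) = X * (fls_const (w i) * X ^ (k - 1 - i))"
      by (simp add: mult_ac)
  qed
  thus ?thesis by (simp add: P_def)
qed

lemma rest_Suc: "rest (Suc k) = X * rest k - fls_const (w k)"
  by (simp add: rest_def P_Suc algebra_simps)

text \<open>By induction, the constant coefficient of \<open>X * rest k\<close> is that of
  \<open>rest k\<close> at \<open>1 / z\<close>. It equals \<open>w k\<close>, since the constant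
  coefficient of \<open>T * X ^ i\<close> vanishes by antisymmetry and so \<open>P k\<close> adds
  nothing to \<open>w k\<close>. This expands \<open>Vneg\<close> in \<open>1 / X\<close> without
  inverting \<open>X\<close>.\<close>

lemma rest_nth_nonneg: "j \<ge> 0 \<Longrightarrow> rest k $z j = 0"
proof (induction k arbitrary: j)
  case 0
  thus ?case by (simp add: rest_def P_def Vneg_nth_nonneg)
next
  case (Suc k)
  have "(T * X ^ i) $z 0 = 0" for i
    by (intro antisym_nth_0 antisym_T_mult sym_X_power)
  hence "(T * P k) $z 0 = 0"
    by (simp add: P_def sum_distrib_left fls_sum_nth mult.left_commute[of T])
  hence "w k = (T * rest k) $z 0"
    by (simp add: w_def rest_def right_diff_distrib mult.left_commute)
  hence "w k = rest k $z (- 1)"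
    using Suc.IH by (simp add: T_mult_nth)
  thus ?case using Suc by (cases "j = 0") (auto simp: rest_Suc X_mult_nth)
qed

lemma X_power_Vneg: "X ^ k * Vneg = P k + rest k"
  by (simp add: rest_def)

lemma P_mult: "P k * f = (\<Sum>i<k. fls_const (w i) * (X ^ (k - 1 - i) * f))"
  by (simp add: P_def sum_distrib_right mult.assoc)

text \<open>One factor \<open>X ^ k * Vneg\<close> is replaced by \<open>P k + rest k\<close>. The
  product of \<open>Vneg\<close> and the tail starts at \<open>z^-2\<close>, and \<open>T\<close>
  raises powers by at most one.\<close>

lemma X_power_Vneg_square: "(X ^ k * (T * (Vneg * Vneg))) $z 0 = (\<Sum>i<k. w i * w (k - 1 - i))"
proof -
  have "X ^ k * (T * (Vneg * Vneg)) = (X ^ k * Vneg) * (T * Vneg)" by (simp only: mult_ac)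
  also have "\<dots> = P k * (T * Vneg) + T * (Vneg * rest k)"
    unfolding X_power_Vneg distrib_right by (simp only: mult_ac)
  finally have "X ^ k * (T * (Vneg * Vneg)) = P k * (T * Vneg) + T * (Vneg * rest k)" .
  moreover have "(Vneg * rest k) $z j = 0" if "j > - 2" for j
    by (rule fls_mult_nth_eq_0[of "- 1" _ "- 1"]) (use that in \<open>auto intro: Vneg_nth_nonneg rest_nth_nonneg\<close>)
  hence "(T * (Vneg * rest k)) $z 0 = 0" by (simp add: T_mult_nth)
  ultimately show ?thesis by (simp add: P_mult fls_sum_nth w_def)
qed

text \<open>The exchange fixes \<open>Vpos * Vneg\<close> and changes the sign of
  \<open>T * X ^ k\<close>, so the constant coefficient is its own negative. In coordinates, the
  summands \<open>t i j\<close> are antisymmetric.\<close>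

lemma X_power_Vpos_Vneg: "(X ^ k * (T * (Vpos * Vneg))) $z 0 = 0"
proof -
  define g where "g = T * X ^ k"
  have g: "R ^ j * g $z (int j - int i) = - (R ^ i * g $z (int i - int j))" for i j
    unfolding g_def by (rule antisym_T_mult[OF sym_X_power, unfolded antisym_def, rule_format])
  define t where "t i j = vn i * (R ^ j * vn j * g $z (int j - int i))" for i j
  have t: "t j i = - t i j" for i j
  proof -
    have "t i j = vn i * vn j * (R ^ j * g $z (int j - int i))" by (simp add: t_def mult_ac)
    also have "\<dots> = - t j i" unfolding g[of j i] by (simp add: t_def mult_ac)
    finally show ?thesis by simp
  qed
  have "Vpos * Vneg * g = (\<Sum>i\<in>{1..Suc K}. \<Sum>j\<in>{1..Suc K}.
      fls_const (vn i) * (fls_const (R ^ j * vn j) * (fls_X ^ i * (fls_X_inv ^ j * g))))"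
    unfolding Vpos_def Vneg_def unfolding sum_product unfolding sum_distrib_right by (simp only: mult_ac)
  hence eq: "(Vpos * Vneg * g) $z 0 = (\<Sum>i\<in>{1..Suc K}. \<Sum>j\<in>{1..Suc K}. t i j)"
    by (simp add: fls_sum_nth t_def del: sum.cl_ivl_Suc)
  also have "\<dots> = (\<Sum>i\<in>{1..Suc K}. \<Sum>j\<in>{1..Suc K}. t j i)" by (rule sum.swap)
  also have "\<dots> = (\<Sum>i\<in>{1..Suc K}. \<Sum>j\<in>{1..Suc K}. - t i j)" by (intro sum.cong refl t)
  also have "\<dots> = - (\<Sum>i\<in>{1..Suc K}. \<Sum>j\<in>{1..Suc K}. t i j)" by (simp only: sum_negf)
  finally have "(Vpos * Vneg * g) $z 0 + (Vpos * Vneg * g) $z 0 = 0"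
    unfolding eq by (simp only: eq_neg_iff_add_eq_0)
  from two_cancel[OF this] show ?thesis by (simp only: g_def mult_ac)
qed

lemma X_power_V': "X ^ k * V' * f = X ^ Suc k * f - (\<Sum>v<K. fls_const (a v) * (X ^ (k + v) * f))"
  by (simp add: V'_def algebra_simps sum_distrib_left sum_distrib_right power_add)

text \<open>Both sides evaluate the constant coefficient of \<open>X ^ k * V' * T * Vneg\<close>:
  one by the definition of \<open>V'\<close>, the other by its splitting.\<close>

lemma w_loop_equation: "w (Suc k) = (\<Sum>i<k. w i * w (k - 1 - i)) + (\<Sum>v<K. a v * w (k + v))"
proof -
  have "w (Suc k) - (\<Sum>v<K. a v * w (k + v)) = (X ^ k * V' * (T * Vneg)) $z 0"
    unfolding X_power_V' by (simp add: w_def fls_sum_nth)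
  also have "X ^ k * V' * (T * Vneg) = X ^ k * (T * (Vpos * Vneg)) + X ^ k * (T * (Vneg * Vneg))"
    by (simp add: V'_split algebra_simps)
  also have "\<dots> $z 0 = (\<Sum>i<k. w i * w (k - 1 - i))"
    by (simp add: X_power_Vpos_Vneg X_power_Vneg_square)
  finally show ?thesis by (simp add: algebra_simps)
qed

text \<open>
  The universal planar covariance of \<open>X\<^sup>n\<close> and \<open>X\<^sup>2\<close>: minus the negative part of
  \<open>z d/dz X\<^sup>2\<close> is \<open>h\<close>, and \<open>h'\<close> is its image under exchanging \<open>z\<close> and \<open>R / z\<close>.
\<close>

definition h :: "'a fls" where
  "h = fls_const (2 * S * R) * fls_X_inv + fls_const (2 * R ^ 2) * fls_X_inv ^ 2"

definition h' :: "'a fls" where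
  "h' = fls_const (2 * S) * fls_X + fls_const 2 * fls_X ^ 2"

definition u :: "nat \<Rightarrow> 'a" where
  "u n = (X ^ n * h) $z 0"

lemma mult_h_nth: "(f * h) $z 0 = 2 * S * R * f $z 1 + 2 * R ^ 2 * f $z 2"
proof -
  have "f * h = fls_const (2 * S * R) * (fls_X_inv * f) + fls_const (2 * R ^ 2) * (fls_X_inv ^ 2 * f)"
    by (simp add: h_def algebra_simps)
  thus ?thesis by simp
qed

lemma mult_h'_nth: "(f * h') $z 0 = 2 * S * f $z (- 1) + 2 * f $z (- 2)"
proof -
  have "f * h' = fls_const (2 * S) * (fls_X * f) + fls_const 2 * (fls_X ^ 2 * f)"
    by (simp add: h'_def algebra_simps)
  thus ?thesis by simp
qed

text \<open>The derivative \<open>z d/dz\<close> of \<open>X ^ 2\<close> is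
  \<open>2 * X * T\<close>; its positive part is \<open>h'\<close> and its negative part is
  \<open>- h\<close>.\<close>

lemma h'_eq: "h' = h + 2 * (X * T)"
proof -
  have "T $z k = (if k = 1 then 1 else if k = - 1 then - R else 0)" for k
    by (simp add: T_def)
  thus ?thesis
    by (intro fls_eqI) (auto simp: h_def h'_def X_mult_nth power2_eq_square)
qed

lemma u_0: "u 0 = 0"
  by (simp add: u_def mult_h_nth[of 1, simplified])

lemma u_2: "u 2 = 4 * R * S ^ 2 + 2 * R ^ 2"
proof -
  have "X ^ 2 $z 1 = 2 * S" "X ^ 2 $z 2 = 1"
    unfolding power2_eq_square X_mult_nth by (simp_all add: X_def)
  thus ?thesis unfolding u_def mult_h_nth by (simp add: power2_eq_square algebra_simps)
qed

lemma X_power_Vneg_h: "(X ^ k * (Vneg * h)) $z 0 = (\<Sum>i<k. w i * u (k - 1 - i))"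
proof -
  have "X ^ k * (Vneg * h) = P k * h + rest k * h"
    using X_power_Vneg[of k] by (metis distrib_right mult.assoc)
  moreover have "(rest k * h) $z 0 = 0" by (simp add: mult_h_nth rest_nth_nonneg)
  ultimately show ?thesis by (simp add: P_mult fls_sum_nth u_def)
qed

text \<open>The exchange fixes \<open>X ^ k\<close> and constant coefficients and carries
  \<open>Vpos * h\<close> to \<open>Vneg * h'\<close>. This is checked term by term, without
  dividing by \<open>R\<close>.\<close>

lemma X_power_Vpos_h: "(X ^ k * (Vpos * h)) $z 0 = (X ^ k * (Vneg * h')) $z 0"
proof -
  define f where "f = X ^ k"
  have f: "R ^ j * f $z (int j - int i) = R ^ i * f $z (int i - int j)" for i j
    using sym_X_power[of k] by (simp add: f_def sym_def)
  have "f * (Vpos * h) = (\<Sum>i\<in>{1..Suc K}. fls_const (vn i) * ((fls_X ^ i * f) * h))"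
    unfolding Vpos_def sum_distrib_left sum_distrib_right by (simp only: mult_ac)
  hence "(f * (Vpos * h)) $z 0 = (\<Sum>i\<in>{1..Suc K}. vn i * (2 * S * R * f $z (1 - int i) + 2 * R ^ 2 * f $z (2 - int i)))"
    by (simp add: fls_sum_nth mult_h_nth del: sum.cl_ivl_Suc)
  also have "\<dots> = (\<Sum>i\<in>{1..Suc K}. R ^ i * vn i * (2 * S * f $z (int i - 1) + 2 * f $z (int i - 2)))"
  proof (rule sum.cong[OF refl])
    fix i
    have 1: "R * f $z (1 - int i) = R ^ i * f $z (int i - 1)" using f[of 1 i] by simp
    have 2: "R ^ 2 * f $z (2 - int i) = R ^ i * f $z (int i - 2)" using f[of 2 i] by simp
    have "vn i * (2 * S * R * f $z (1 - int i) + 2 * R ^ 2 * f $z (2 - int i)) =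
        vn i * (2 * S * (R * f $z (1 - int i)) + 2 * (R ^ 2 * f $z (2 - int i)))"
      by (simp add: algebra_simps)
    thus "vn i * (2 * S * R * f $z (1 - int i) + 2 * R ^ 2 * f $z (2 - int i)) =
        R ^ i * vn i * (2 * S * f $z (int i - 1) + 2 * f $z (int i - 2))"
      unfolding 1 2 by (simp add: algebra_simps)
  qed
  also have "\<dots> = (f * (Vneg * h')) $z 0"
  proof -
    have "f * (Vneg * h') = (\<Sum>i\<in>{1..Suc K}. fls_const (R ^ i * vn i) * ((fls_X_inv ^ i * f) * h'))"
      unfolding Vneg_def sum_distrib_left sum_distrib_right by (simp only: mult_ac)
    thus ?thesis by (simp add: fls_sum_nth mult_h'_nth del: sum.cl_ivl_Suc)
  qed
  finally show ?thesis by (simp add: f_def)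
qed

text \<open>As for \<open>w\<close>, with \<open>h\<close> in place of \<open>T * Vneg\<close>.
  Turning \<open>h'\<close> back into \<open>h\<close> doubles the convolution and yields the term
  \<open>2 * w (Suc k)\<close>.\<close>

lemma u_loop_equation:
  "u (Suc k) = 2 * (\<Sum>i<k. w i * u (k - 1 - i)) + (\<Sum>v<K. a v * u (k + v)) + 2 * w (Suc k)"
proof -
  have "u (Suc k) - (\<Sum>v<K. a v * u (k + v)) = (X ^ k * V' * h) $z 0"
    unfolding X_power_V' by (simp add: u_def fls_sum_nth)
  also have "X ^ k * V' * h = X ^ k * (Vpos * h) + X ^ k * (Vneg * h)"
    by (simp add: V'_split algebra_simps)
  also have "\<dots> $z 0 = (X ^ k * (Vneg * h')) $z 0 + (\<Sum>i<k. w i * u (k - 1 - i))"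
    by (simp add: X_power_Vpos_h X_power_Vneg_h)
  also have "X ^ k * (Vneg * h') = X ^ k * (Vneg * h) + 2 * (X ^ Suc k * (T * Vneg))"
    by (simp add: h'_eq algebra_simps)
  also have "\<dots> $z 0 = (\<Sum>i<k. w i * u (k - 1 - i)) + 2 * w (Suc k)"
    by (simp add: X_power_Vneg_h w_def)
  finally show ?thesis by (simp add: algebra_simps)
qed

end


subsection \<open>Identification of the planar limit\<close>

text \<open>Uniqueness for recursions that lower the total weight, the index plus the weight of the
  monomial.\<close>

lemma graded_eqI:
  fixes W W' :: "nat \<Rightarrow> rat aseries"
  assumes "W 0 = W' 0"
    and "\<And>k m. (\<And>k' m'. k' + adeg m' < Suc k + adeg m \<Longrightarrow> mcoeff (W k') m' = mcoeff (W' k') m') \<Longrightarrow>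
           mcoeff (W (Suc k)) m = mcoeff (W' (Suc k)) m"
  shows "W = W'"
proof -
  have "mcoeff (W n) m = mcoeff (W' n) m" for n m
  proof (induction "n + adeg m" arbitrary: n m rule: less_induct)
    case less
    show ?case
    proof (cases n)
      case (Suc k)
      show ?thesis unfolding Suc by (rule assms(2)) (use less Suc in auto)
    qed (simp add: assms(1))
  qed
  thus ?thesis by (intro ext mseries_eqI)
qed

lemma adeg_mono: "a \<subseteq># m \<Longrightarrow> adeg a \<le> adeg m"
  by (auto simp: subset_mset.le_iff_add)

lemma msum_eq_vsum: "msum (\<lambda>n. avar n * f n) {1..} = vsum (\<lambda>v. f (Suc v))"
  for f :: "nat \<Rightarrow> 'a :: comm_ring_1 aseries"
proof (rule mseries_eqI)
  fix m :: "nat multiset"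
  have "mcoeff (msum (\<lambda>n. avar n * f n) {1..}) m = (\<Sum>n\<in>Suc ` set_mset m. mcoeff (avar n * f n) m)"
  proof (rule mcoeff_msum)
    fix n assume "n \<in> {1..} - Suc ` set_mset m"
    hence "n - 1 \<notin> set_mset m" by (cases n) auto
    thus "mcoeff (avar n * f n) m = 0" by (simp add: avar_def mcoeff_var_mult)
  qed auto
  also have "\<dots> = mcoeff (vsum (\<lambda>v. f (Suc v))) m"
    by (simp add: sum.reindex avar_def mcoeff_var_mult vsum_def)
  finally show "mcoeff (msum (\<lambda>n. avar n * f n) {1..}) m = mcoeff (vsum (\<lambda>v. f (Suc v))) m" .
qed

text \<open>Both sides count disjoint choices of \<open>j - 1\<close> and of \<open>j\<close> among
  \<open>v\<close> elements. It reconciles \<open>X_power_nth\<close> for \<open>d = 1\<close> with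
  the equation for \<open>R\<close>.\<close>

lemma choose_central:
  assumes "1 \<le> j" "2 * j \<le> Suc v"
  shows "(v choose (2 * j - 1)) * ((2 * j - 1) choose j) = (v choose (j - 1)) * ((Suc v - j) choose j)"
proof -
  have "(2 * j - 1) choose j = (2 * j - 1) choose (j - 1)"
    using assms binomial_symmetric[of j "2 * j - 1"] by (simp add: algebra_simps)
  moreover have "2 * j - 1 - (j - 1) = j" "v - (j - 1) = Suc v - j" using assms by auto
  ultimately show ?thesis
    using choose_mult[of "j - 1" "2 * j - 1" v] assms by simp
qed

text \<open>After truncation \<open>W\<close> and \<open>w\<close> obey the same recursion, and then
  \<open>U\<close> and \<open>u\<close> do; the right-hand side is \<open>u 2\<close>. Truncations
  determine the series, as a monomial has finitely many variables.\<close>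

lemma planar_two_point:
  assumes "RS_system R S"
  shows "2 * pd 1 (planar 2) = 4 * R * S ^ 2 + 2 * R ^ 2"
proof -
  have trunc_eq: "trunc {..<K} (2 * pd 1 (planar 2)) = trunc {..<K} (4 * R * S ^ 2 + 2 * R ^ 2)" if K: "K > 1" for K
  proof -
    define V where "V = {..<K}"
    have V: "finite V" "1 \<in> V" using K by (auto simp: V_def)
    define r q where "r = trunc V R" and "q = trunc V S"
    define W where "W n = trunc V (planar n)" for n
    define U where "U n = 2 * pd 1 (W n)" for n
    interpret spectral_curve r q "\<lambda>v. mvar v :: rat aseries" K
    proof
      fix b :: "rat aseries" assume b: "b + b = 0"
      have "mcoeff b m = 0" for m using arg_cong[OF b, of "\<lambda>f. mcoeff f m"] by simp
      thus "b = 0" by (intro mseries_eqI) simp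
    qed
    have r: "r = 1 + (\<Sum>v\<in>V. mvar v * (X ^ v $z (- 1)))"
    proof -
      have "(X ^ v $z (- 1)) = (\<Sum>j\<in>{1..Suc v div 2}.
          of_nat ((v choose (j - 1)) * ((Suc v - j) choose j)) * r ^ j * q ^ (Suc v - 2 * j))" for v
        unfolding X_power_nth[of v 1, simplified of_nat_1] Suc_eq_plus1[symmetric]
        by (intro sum.cong refl) (subst choose_central, auto)
      moreover have "r = 1 + trunc V (vsum (\<lambda>v. \<Sum>j\<in>{1..Suc v div 2}.
          of_nat ((v choose (j - 1)) * ((Suc v - j) choose j)) * R ^ j * S ^ (Suc v - 2 * j)))"
      proof -
        have "R = 1 + vsum (\<lambda>v. \<Sum>j\<in>{1..Suc v div 2}.
            of_nat ((v choose (j - 1)) * ((Suc v - j) choose j)) * R ^ j * S ^ (Suc v - 2 * j))"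
          using assms unfolding RS_system_def msum_eq_vsum diff_Suc_1 by blast
        from arg_cong[OF this, of "trunc V"] show ?thesis
          unfolding r_def trunc_add trunc_one .
      qed
      ultimately show ?thesis using V
        by (simp add: trunc_vsum r_def q_def del: of_nat_mult)
    qed
    have q: "q = (\<Sum>v\<in>V. mvar v * (X ^ v $z 0))"
    proof -
      have "(X ^ v $z 0) = (\<Sum>j\<in>{0..v div 2}.
          of_nat ((v choose (2 * j)) * ((2 * j) choose j)) * r ^ j * q ^ (v - 2 * j))" for v
        using X_power_nth[of v 0] by (simp del: of_nat_mult)
      moreover have "q = trunc V (vsum (\<lambda>v. \<Sum>j\<in>{0..v div 2}.
          of_nat ((v choose (2 * j)) * ((2 * j) choose j)) * R ^ j * S ^ (v - 2 * j)))"
      proof -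
        have e: "Suc v - 2 * j - 1 = v - 2 * j" for v j by simp
        have "S = vsum (\<lambda>v. \<Sum>j\<in>{0..(Suc v - 1) div 2}.
            of_nat ((Suc v - 1 choose (2 * j)) * ((2 * j) choose j)) * R ^ j * S ^ (Suc v - 2 * j - 1))"
          using assms unfolding RS_system_def msum_eq_vsum by blast
        from arg_cong[OF this, of "trunc V"] show ?thesis
          unfolding q_def e diff_Suc_1 .
      qed
      ultimately show ?thesis using V
        by (simp add: trunc_vsum r_def q_def del: of_nat_mult)
    qed
    interpret normalized_spectral_curve r q "\<lambda>v. mvar v :: rat aseries" K
    proof
      have "V' $z 0 = q - (\<Sum>v\<in>V. mvar v * (X ^ v $z 0))"
        by (simp add: V'_def fls_sum_nth V_def) (simp add: X_def)
      thus "V' $z 0 = 0" using q by simp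
      have V'_1: "V' $z (- 1) = r - (\<Sum>v\<in>V. mvar v * (X ^ v $z (- 1)))"
        by (simp add: V'_def fls_sum_nth V_def) (simp add: X_def)
      show "V' $z (- 1) = 1" unfolding V'_1 diff_eq_eq by (rule r)
    qed
    have W_0: "W 0 = 1" by (simp add: W_def planar_def)
    have W_Suc: "W (Suc k) = (\<Sum>j<k. W j * W (k - 1 - j)) + (\<Sum>v<K. mvar v * W (k + v))" for k
      using V unfolding W_def planar_loop_equation by (simp add: trunc_vsum V_def)
    have "W = w"
    proof (rule graded_eqI)
      fix k m
      assume IH: "\<And>k' m'. k' + adeg m' < Suc k + adeg m \<Longrightarrow> mcoeff (W k') m' = mcoeff (w k') m'"
      have "mcoeff (W j * W (k - 1 - j)) m = mcoeff (w j * w (k - 1 - j)) m" if "j < k" for j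
        by (rule mcoeff_mult_cong; rule IH) (use that adeg_mono in force)+
      moreover have "mcoeff (mvar v * W (k + v)) m = mcoeff (mvar v * w (k + v)) m" for v
        using IH[of "k + v" "m - {#v#}"] adeg_remove[of v m] by (simp add: mcoeff_var_mult)
      ultimately show "mcoeff (W (Suc k)) m = mcoeff (w (Suc k)) m"
        unfolding W_Suc w_loop_equation by simp
    qed (simp add: W_0 w_0)
    have U_Suc: "U (Suc k) = 2 * (\<Sum>j<k. w j * U (k - 1 - j)) + (\<Sum>v<K. mvar v * U (k + v)) + 2 * w (Suc k)" for k
    proof -
      \<comment> \<open>Reversing the index makes the two terms of the product rule equal, whence
        the factor 2.\<close>
      have "(\<Sum>j<k. pd 1 (W j) * W (k - 1 - j)) = (\<Sum>j<k. W j * pd 1 (W (k - 1 - j)))"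
        by (rule sum.reindex_bij_witness[of _ "\<lambda>j. k - 1 - j" "\<lambda>j. k - 1 - j"]) auto
      hence "pd 1 (W (Suc k)) =
          2 * (\<Sum>j<k. W j * pd 1 (W (k - 1 - j))) +
            ((\<Sum>v<K. pd 1 (mvar v) * W (k + v)) + (\<Sum>v<K. mvar v * pd 1 (W (k + v))))"
        unfolding W_Suc[of k] pd_add pd_sum pd_mult sum.distrib
        by (simp only: mult_2)
      \<comment> \<open>Differentiating the explicit a(2), of index 1, gives the source term of the
        equation for \<open>u\<close>.\<close>
      moreover have "(\<Sum>v<K. pd 1 (mvar v) * W (k + v)) = W (Suc k)"
      proof -
        have "(\<Sum>v<K. pd 1 (mvar v) * W (k + v)) = (\<Sum>v<K. if v = 1 then W (Suc k) else 0)"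
          by (rule sum.cong) (auto simp: pd_var)
        thus ?thesis using K by simp
      qed
      moreover have "(\<Sum>j<k. w j * U (k - 1 - j)) = 2 * (\<Sum>j<k. W j * pd 1 (W (k - 1 - j)))"
        by (simp only: U_def \<open>W = w\<close> sum_distrib_left mult.left_commute[of 2])
      moreover have "(\<Sum>v<K. mvar v * U (k + v)) = 2 * (\<Sum>v<K. mvar v * pd 1 (W (k + v)))"
        by (simp only: U_def sum_distrib_left mult.left_commute[of 2])
      ultimately show ?thesis
        by (simp only: U_def[of "Suc k"] \<open>W = w\<close> distrib_left add_ac)
    qed
    have "U = u"
    proof (rule graded_eqI)
      fix k m
      assume IH: "\<And>k' m'. k' + adeg m' < Suc k + adeg m \<Longrightarrow> mcoeff (U k') m' = mcoeff (u k') m'"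
      have "mcoeff (w j * U (k - 1 - j)) m = mcoeff (w j * u (k - 1 - j)) m" if "j < k" for j
        by (rule mcoeff_mult_cong; (rule refl | rule IH)) (use that adeg_mono in force)+
      moreover have "mcoeff (mvar v * U (k + v)) m = mcoeff (mvar v * u (k + v)) m" for v
        using IH[of "k + v" "m - {#v#}"] adeg_remove[of v m] by (simp add: mcoeff_var_mult)
      ultimately show "mcoeff (U (Suc k)) m = mcoeff (u (Suc k)) m"
        unfolding U_Suc u_loop_equation by simp
    qed (simp add: U_def W_0 u_0)
    have num: "trunc V (numeral n) = (numeral n :: rat aseries)" for n
      using trunc_of_nat[of V "numeral n"] by simp
    have "U 2 = trunc V (2 * pd 1 (planar 2))"
      using V by (simp add: U_def W_def pd_trunc num)
    thus ?thesis unfolding \<open>U = u\<close> u_2 by (simp add: r_def q_def V_def num[unfolded V_def])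
  qed
  show ?thesis
  proof (rule mseries_eqI)
    fix m :: "nat multiset"
    \<comment> \<open>Larger than every index in \<open>m\<close>, and at least 2 so that a(2)
      survives the truncation.\<close>
    define K where "K = Suc (Suc (\<Sum>v\<in>set_mset m. v))"
    have "set_mset m \<subseteq> {..<K}"
      using member_le_sum[of _ "set_mset m" "\<lambda>v. v"] by (force simp: K_def)
    thus "mcoeff (2 * pd 1 (planar 2)) m = mcoeff (4 * R * S ^ 2 + 2 * R ^ 2) m"
      using arg_cong[OF trunc_eq[of K], of "\<lambda>f. mcoeff f m"] by (simp only: mcoeff_trunc K_def) simp
  qed
qed

lemma free_energy_coeff:
  assumes "RS_system R S"
  shows "of_nat (adeg m * (adeg m + 2)) * mcoeff (free_energy 0) m =
     2 * mcoeff (2 * R * S ^ 2 + R ^ 2 - 1) m"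
  unfolding planar_euler planar_two_point[OF assms]
  by (simp add: mcoeff_one mult.assoc)

subsection \<open>Weighted homogeneous components\<close>

lemma mcoeff_scale_t: "mcoeff (fps_nth (scale_t f) d) m = (if adeg m = d then mcoeff f m else 0)"
  by (simp add: scale_t_def)

lemma scale_t_add: "scale_t (f + g) = scale_t f + scale_t g"
  for f g :: "'a :: comm_ring_1 aseries"
  by (intro fps_ext mseries_eqI) (simp add: mcoeff_scale_t)

lemma scale_t_diff: "scale_t (f - g) = scale_t f - scale_t g"
  for f g :: "'a :: comm_ring_1 aseries"
  by (intro fps_ext mseries_eqI) (simp add: mcoeff_scale_t)

lemma scale_t_one: "scale_t (1 :: 'a :: comm_ring_1 aseries) = 1"
proof (intro fps_ext mseries_eqI)
  fix d and m :: "nat multiset"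
  have "adeg m = 0 \<longleftrightarrow> m = {#}" by (cases m) auto
  thus "mcoeff (fps_nth (scale_t (1 :: 'a aseries)) d) m = mcoeff (fps_nth 1 d) m"
    by (auto simp: mcoeff_scale_t mcoeff_one)
qed

text \<open>Weights add up when monomials are multiplied, so the substitution respects
  products.\<close>

lemma scale_t_mult: "scale_t (f * g) = scale_t f * scale_t g"
  for f g :: "'a :: comm_ring_1 aseries"
proof (intro fps_ext mseries_eqI)
  fix d m
  have "mcoeff (fps_nth (scale_t f * scale_t g) d) m =
      (\<Sum>i = 0..d. \<Sum>(a, b)\<in>{(a, b). a + b = m}.
         if adeg a = i \<and> adeg b = d - i then mcoeff f a * mcoeff g b else 0)"
    by (simp add: fps_mult_nth mcoeff_mult mcoeff_scale_t case_prod_unfold if_distrib cong: if_cong)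
       (intro sum.cong refl, auto)
  also have "\<dots> = (\<Sum>(a, b)\<in>{(a, b). a + b = m}. \<Sum>i = 0..d.
         if adeg a = i \<and> adeg b = d - i then mcoeff f a * mcoeff g b else 0)"
    unfolding case_prod_unfold by (rule sum.swap)
  also have "\<dots> = (\<Sum>(a, b)\<in>{(a, b). a + b = m}. if adeg m = d then mcoeff f a * mcoeff g b else 0)"
  proof (intro sum.cong refl, clarify)
    fix a b :: "nat multiset"
    have "(\<Sum>i = 0..d. if adeg a = i \<and> adeg b = d - i then mcoeff f a * mcoeff g b else 0) =
        (\<Sum>i = 0..d. if i = adeg a then if adeg a + adeg b = d then mcoeff f a * mcoeff g b else 0 else 0)"
      by (rule sum.cong) auto
    also have "\<dots> = (if adeg (a + b) = d then mcoeff f a * mcoeff g b else 0)"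
      by auto
    finally show "(\<Sum>i = 0..d. if adeg a = i \<and> adeg b = d - i then mcoeff f a * mcoeff g b else 0) =
        (if adeg (a + b) = d then mcoeff f a * mcoeff g b else 0)" .
  qed
  also have "\<dots> = mcoeff (fps_nth (scale_t (f * g)) d) m"
    by (simp add: mcoeff_scale_t mcoeff_mult case_prod_unfold)
  finally show "mcoeff (fps_nth (scale_t (f * g)) d) m = mcoeff (fps_nth (scale_t f * scale_t g) d) m" ..
qed

section \<open>The termwise integral\<close>

lemma in_s_add: "in_s (f + g) = in_s f + in_s g"
  for f g :: "'a :: comm_ring_1 fps"
  by (rule fls_eqI) (simp add: in_s_def flip: fps_const_add)

lemma in_s_diff: "in_s (f - g) = in_s f - in_s g"
  for f g :: "'a :: comm_ring_1 fps"
  by (rule fls_eqI) (simp add: in_s_def flip: fps_const_sub)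

lemma in_s_one: "in_s (1 :: 'a :: comm_ring_1 fps) = 1"
  by (rule fls_eqI) (simp add: in_s_def)

lemma in_s_mult: "in_s (f * g) = in_s f * in_s g"
  for f g :: "'a :: comm_ring_1 fps"
proof -
  have const_sum: "fps_const (\<Sum>i\<in>A. c i) = (\<Sum>i\<in>A. fps_const (c i))" for A :: "nat set" and c :: "nat \<Rightarrow> 'a"
    by (induction A rule: infinite_finite_induct) (auto simp flip: fps_const_add)
  have "Abs_fps (\<lambda>k. fps_const (fps_nth (f * g) k)) =
      Abs_fps (\<lambda>k. fps_const (fps_nth f k)) * Abs_fps (\<lambda>k. fps_const (fps_nth g k))"
    by (rule fps_ext) (simp add: fps_mult_nth const_sum)
  thus ?thesis by (simp add: in_s_def fls_times_fps_to_fls)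
qed

lemma in_s_nth: "fls_nth (in_s f) k = (if k < 0 then 0 else fps_const (fps_nth f (nat k)))"
  by (simp add: in_s_def)

text \<open>With \<open>d = n - 2\<close>, the integral of \<open>(t - s) / (2 s)\<close> times the
  power \<open>d / 2\<close> of \<open>s\<close> is \<open>1 / d - 1 / (d + 2)\<close> times the
  power \<open>d / 2 + 1\<close> of \<open>t\<close>. The assumption on \<open>G\<close> excludes a
  logarithm.\<close>

lemma fps_nth_integral_0_t:
  fixes G :: "rat aseries fps"
  assumes "fps_nth G 0 = 0"
  shows "fps_nth (integral_0_t (fls_const (fps_const (mconst (1 / 2))) * s_inv * (t_const - s_var) * in_s G)) n =
     (if n < 3 then 0 else mconst (2 / of_nat ((n - 2) * n)) * fps_nth G (n - 2))"
proof -
  define H where "H = fls_const (fps_const (mconst (1 / 2))) * s_inv * (t_const - s_var) * in_s G"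
  have H: "fls_nth H k = fps_const (mconst (1 / 2)) * (fps_X ^ 2 * fls_nth (in_s G) (k + 2) - fls_nth (in_s G) k)" for k
  proof -
    have "H = fls_const (fps_const (mconst (1 / 2))) * (fls_X_inv ^ 2 * (fls_const (fps_X ^ 2) * in_s G)) -
        fls_const (fps_const (mconst (1 / 2))) * (fls_X_inv ^ 2 * (fls_X ^ 2 * in_s G))"
      unfolding H_def s_inv_def t_const_def s_var_def by (simp add: algebra_simps)
    thus ?thesis by (simp add: right_diff_distrib)
  qed
  \<comment> \<open>\<open>A\<close> comes from \<open>t\<close> and \<open>B\<close> from
    \<open>s\<close> in the factor \<open>t - s\<close>. For \<open>n = 3\<close> the term
    \<open>A\<close> sits at \<open>k = -1\<close>, the lowest exponent that the integral
    admits.\<close>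
  define A where "A k = (if k = int n - 4 \<and> n \<ge> 3 then mconst (1 / of_int (k + 2)) * fps_nth G (n - 2) else 0)" for k
  define B where "B k = (if k = int n - 2 \<and> n \<ge> 3 then mconst (1 / of_int (k + 2)) * fps_nth G (n - 2) else 0)" for k
  have AB: "mconst (2 / of_int (k + 2)) * fps_nth (fls_nth H k) (nat (int n - 2 - k)) = A k - B k"
    if k: "k \<in> {-1..int n - 2}" for k
  proof -
    have m: "mconst (2 / c) * (mconst (1 / 2) * f) = mconst (1 / c) * f" for c and f :: "rat aseries"
      by (rule mseries_eqI) simp
    have X2: "fps_nth (fps_X ^ 2 * fps_const c) j = (if j = 2 then c else 0)" for c :: "rat aseries" and j
      by (simp add: fps_X_power_mult_nth)
    have "mconst (1 / of_int (k + 2)) * fps_nth (fps_X ^ 2 * fls_nth (in_s G) (k + 2)) (nat (int n - 2 - k)) = A k"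
      using k by (auto simp: in_s_nth X2 A_def nat_diff_distrib')
    moreover have "mconst (1 / of_int (k + 2)) * fps_nth (fls_nth (in_s G) k) (nat (int n - 2 - k)) = B k"
    proof (cases "k = int n - 2")
      case True
      thus ?thesis using k assms by (cases "n < 3") (auto simp: in_s_nth B_def nat_diff_distrib' numeral_3_eq_3 less_Suc_eq)
    qed (use k in \<open>auto simp: in_s_nth B_def\<close>)
    ultimately show ?thesis by (simp add: H m right_diff_distrib)
  qed
  have "fps_nth (integral_0_t H) n = (\<Sum>k\<in>{-1..int n - 2}. A k - B k)"
    unfolding integral_0_t_def fps_nth_Abs_fps by (intro sum.cong refl AB)
  also have "\<dots> = (\<Sum>k\<in>{-1..int n - 2}. A k) - (\<Sum>k\<in>{-1..int n - 2}. B k)"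
    by (rule sum_subtractf)
  also have "\<dots> = (if n < 3 then 0 else mconst (2 / of_nat ((n - 2) * n)) * fps_nth G (n - 2))"
  proof (cases "n < 3")
    case False
    have "(\<Sum>k\<in>{-1..int n - 2}. A k) = mconst (1 / of_nat (n - 2)) * fps_nth G (n - 2)"
    proof -
      have "(\<Sum>k\<in>{-1..int n - 2}. A k) = (\<Sum>k\<in>{int n - 4}. A k)"
        by (rule sum.mono_neutral_right) (use False in \<open>auto simp: A_def\<close>)
      thus ?thesis using False by (simp add: A_def of_nat_diff)
    qed
    moreover have "(\<Sum>k\<in>{-1..int n - 2}. B k) = mconst (1 / of_nat n) * fps_nth G (n - 2)"
    proof -
      have "(\<Sum>k\<in>{-1..int n - 2}. B k) = (\<Sum>k\<in>{int n - 2}. B k)"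
        by (rule sum.mono_neutral_right) (use False in \<open>auto simp: B_def\<close>)
      thus ?thesis using False by (simp add: B_def)
    qed
    moreover have "mconst (1 / of_nat (n - 2)) * f - mconst (1 / of_nat n) * f =
        mconst (2 / of_nat ((n - 2) * n)) * f" for f :: "rat aseries"
    proof -
      have "1 / of_nat (n - 2) - 1 / of_nat n = (2 / of_nat ((n - 2) * n) :: rat)"
        using False by (simp add: field_simps of_nat_diff)
      moreover have "mconst b * f - mconst c * f = mconst (b - c) * f" for b c
        by (rule mseries_eqI) (simp add: left_diff_distrib)
      ultimately show ?thesis by (simp only:)
    qed
    ultimately show ?thesis using False by simp
  qed (simp add: A_def B_def)
  finally show ?thesis by (simp only: H_def)
qed

theorem theorem1p3:
  fixes R S :: "rat aseries"
  assumes "RS_system R S"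
  shows "let Rt = scale_t R; St = scale_t S; Ft = scale_t (free_energy 0) in
    fps_to_fls Ft =
      t_inv *
      fps_to_fls (integral_0_t
        (fls_const (fps_const (mconst (1 / 2))) * s_inv * (t_const - s_var) *
         (2 * in_s Rt * in_s St ^ 2 + in_s Rt ^ 2 - 1))) \<and>
    deriv_t (t_var ^ 2 * deriv_t (fps_to_fls Ft)) =
      fls_const (mconst (1 / 2)) * fps_to_fls (2 * Rt * St ^ 2 + Rt ^ 2 - 1)"
proof -
  define g where "g = 2 * R * S ^ 2 + R ^ 2 - 1"
  define G where "G = scale_t g"
  define Ft where "Ft = scale_t (free_energy 0)"
  have G: "G = 2 * scale_t R * scale_t S ^ 2 + scale_t R ^ 2 - 1"
    using scale_t_add[of 1 "1 :: rat aseries"]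
    by (simp add: G_def g_def scale_t_add scale_t_diff scale_t_one scale_t_mult power2_eq_square)
  have in_s_G: "in_s G = 2 * in_s (scale_t R) * in_s (scale_t S) ^ 2 + in_s (scale_t R) ^ 2 - 1"
    using in_s_add[of 1 "1 :: rat aseries fps"]
    by (simp add: G in_s_add in_s_diff in_s_one in_s_mult power2_eq_square)
  \<comment> \<open>Both claims are comparisons of coefficients with this relation.\<close>
  have coeff: "mconst (of_nat (d * (d + 2))) * fps_nth Ft d = 2 * fps_nth G d" for d
    using free_energy_coeff[OF assms]
    by (intro mseries_eqI) (auto simp: Ft_def G_def g_def mcoeff_scale_t)
  \<comment> \<open>At \<open>d = 0\<close> the left-hand side vanishes; so the integrand has no
    term in \<open>1 / s\<close>.\<close>
  have G_0: "fps_nth G 0 = 0"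
    using coeff[of 0] by (intro mseries_eqI) (auto dest: arg_cong[of _ _ "\<lambda>f. mcoeff f _"])
  have Ft_0: "fps_nth Ft 0 = 0"
  proof (rule mseries_eqI)
    fix m
    show "mcoeff (fps_nth Ft 0) m = mcoeff 0 m"
      by (cases m) (simp_all add: Ft_def mcoeff_scale_t mcoeff_free_energy_empty)
  qed
  have "fps_to_fls Ft = t_inv * fps_to_fls (integral_0_t
      (fls_const (fps_const (mconst (1 / 2))) * s_inv * (t_const - s_var) * in_s G))" (is "_ = t_inv * fps_to_fls ?I")
  proof (rule fls_eqI)
    fix k :: int
    have "fls_nth (t_inv * fps_to_fls ?I) k = fls_nth (fps_to_fls ?I) (k + 2)"
      by (simp add: t_inv_def)
    also have "\<dots> = fls_nth (fps_to_fls Ft) k"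
    proof (cases "k \<ge> 1")
      case True
      define d where "d = nat k"
      have d: "d \<ge> 1" "k = int d" using True by (auto simp: d_def)
      have "fls_nth (fps_to_fls ?I) (k + 2) = fps_nth ?I (d + 2)"
        using d by (simp add: nat_add_distrib)
      also have "\<dots> = mconst (2 / of_nat (d * (d + 2))) * fps_nth G d"
        using d by (subst fps_nth_integral_0_t[OF G_0]) simp
      also have "\<dots> = mconst (1 / of_nat (d * (d + 2))) * (2 * fps_nth G d)"
        by (rule mseries_eqI) simp
      also have "\<dots> = fps_nth Ft d"
      proof -
        have "mconst (1 / c) * (mconst c * f) = f" if "c \<noteq> 0" for c and f :: "rat aseries"
          using that by (intro mseries_eqI) simp
        moreover have "of_nat (d * (d + 2)) \<noteq> (0 :: rat)"
          using d unfolding of_nat_eq_0_iff by simp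
        ultimately show ?thesis unfolding coeff[symmetric] by blast
      qed
      finally show ?thesis using d by simp
    next
      case False
      hence "fls_nth (fps_to_fls ?I) (k + 2) = 0"
        by (simp add: fps_nth_integral_0_t[OF G_0])
      thus ?thesis using False Ft_0 by (cases "k = 0") auto
    qed
    finally show "fls_nth (fps_to_fls Ft) k = fls_nth (t_inv * fps_to_fls ?I) k" ..
  qed
  moreover have "deriv_t (t_var ^ 2 * deriv_t (fps_to_fls Ft)) = fls_const (mconst (1 / 2)) * fps_to_fls G"
  proof (rule fls_eqI)
    fix k :: int
    have "t_var ^ 2 = fls_X ^ 4" by (simp add: t_var_def flip: power_mult)
    \<comment> \<open>The shifts by the two derivatives and by the square of \<open>t\<close>
      cancel, leaving the factors \<open>k / 2\<close> and \<open>(k + 2) / 2\<close>.\<close>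
    hence "fls_nth (deriv_t (t_var ^ 2 * deriv_t (fps_to_fls Ft))) k =
        mconst (of_int (k + 2) / 2) * (mconst (of_int k / 2) * fls_nth (fps_to_fls Ft) k)"
      by (simp add: deriv_t_nth)
    also have "\<dots> = mconst (1 / 2) * fls_nth (fps_to_fls G) k"
    proof (cases "k < 0")
      case False
      define d where "d = nat k"
      have d: "k = int d" using False by (simp add: d_def)
      have "mconst (of_int (k + 2) / 2) * (mconst (of_int k / 2) * fps_nth Ft d) =
          mconst (1 / 4) * (mconst (of_nat (d * (d + 2))) * fps_nth Ft d)"
        by (rule mseries_eqI) (simp add: d, simp add: algebra_simps)
      also have "\<dots> = mconst (1 / 2) * fps_nth G d"
        unfolding coeff by (rule mseries_eqI) simp
      finally show ?thesis using d by simp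
    qed simp
    finally show "fls_nth (deriv_t (t_var ^ 2 * deriv_t (fps_to_fls Ft))) k =
        fls_nth (fls_const (mconst (1 / 2)) * fps_to_fls G) k" by simp
  qed
  ultimately show ?thesis unfolding Let_def in_s_G unfolding G Ft_def by blast
qed

end
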